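(* The Laver forcing $\mathbb{L}$ forces $\mathfrak{c}=|(\mathfrak{b}^{+\epsilon})^{V}|$.
   Context: The Laver forcing $\mathbb{L}$ consists of infinite trees $T\subseteq\omega^{<\omega}$ with a root (stem) $\mathrm{root}(T)$ such that every $t\in T$ with $\mathrm{root}(T)\subseteq t$ has infinitely many immediate successors in $T$; conditions are ordered by reverse inclusion (smaller tree is stronger). For $X\in[\omega]^\omega$ (infinite subsets of $\omega$), $\mu_X$ is the increasing enumeration of $X$. A family $\mathcal{F}\subseteq[\omega]^\omega$ is weakly dominating if for every $Y\in[\omega]^\omega$ there is $X\in\mathcal{F}$ such that for infinitely many $i$, for all $j<2^i$, $|[\mu_X(2^i+j),\mu_X(2^i+j+1))\cap Y|\geq 2$; $\mathfrak{b}^{+\epsilon}$ is the minimal size of a weakly dominating family, and $(\mathfrak{b}^{+\epsilon})^V$ is its ground-model value. $\mathfrak{c}$ is the cardinality of the continuum. *)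

theory Defs
  imports
    "HOL-Library.Infinite_Set"
    "HOL-Library.Sublist"
    "HOL-Library.Equipollence"
begin

unbundle cardinal_syntax

section \<open>The cardinal \<open>\<bb>\<^sup>+\<^sup>\<epsilon>\<close>\<close>

text \<open>\<^term>\<open>enumerate X\<close> is the increasing enumeration \<open>\<mu>\<^sub>X\<close>, starting at index \<open>0\<close>.\<close>

definition weakly_dominating :: "nat set set \<Rightarrow> bool" where
  "weakly_dominating F \<longleftrightarrow>
     (\<forall>X\<in>F. infinite X) \<and>
     (\<forall>Y. infinite Y \<longrightarrow>
        (\<exists>X\<in>F. \<exists>\<^sub>\<infinity>i. \<forall>j<2 ^ i.
           card ({enumerate X (2 ^ i + j)..<enumerate X (2 ^ i + j + 1)} \<inter> Y) \<ge> 2))"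

text \<open>
  The cardinal is a cardinal order in the sense of \<^theory>\<open>HOL.BNF_Cardinal_Order_Relation\<close>: a
  well-order of minimal type on the set it is the cardinality of, so its field stands for the
  initial ordinal \<open>\<bb>\<^sup>+\<^sup>\<epsilon>\<close>.  Any two choices are order isomorphic.
\<close>

definition b_plus_eps :: "nat set rel" where
  "b_plus_eps =
     (SOME \<kappa>. (\<exists>F. weakly_dominating F \<and> \<kappa> = |F| ) \<and>
              (\<forall>G. weakly_dominating G \<longrightarrow> \<kappa> \<le>o |G| ))"

lemma weakly_dominating_all_infinite: "weakly_dominating {X. infinite X}"
  unfolding weakly_dominating_def
proof (intro conjI allI impI)
  fix Y :: "nat set" assume Y: "infinite Y"
  define X where "X = range (\<lambda>k. enumerate Y (2 * k))"
  have sm: "strict_mono (\<lambda>k. enumerate Y (2 * k))"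
    using Y by (intro strict_monoI) simp
  then have inf: "infinite X"
    unfolding X_def by (meson finite_imageD infinite_UNIV_nat strict_mono_imp_inj_on)
  have sme: "strict_mono (enumerate X)"
    using inf by (intro strict_monoI) simp
  have "range (enumerate X) = range (\<lambda>k. enumerate Y (2 * k))"
    using range_enumerate[OF inf] X_def by simp
  then have en: "enumerate X = (\<lambda>k. enumerate Y (2 * k))"
  proof -
    assume r: "range (enumerate X) = range (\<lambda>k. enumerate Y (2 * k))"
    have "enumerate X n = enumerate Y (2 * n)" for n
    proof (induction n rule: less_induct)
      case (less n)
      obtain a where a: "enumerate X n = enumerate Y (2 * a)" using r by blast
      obtain b where b: "enumerate X b = enumerate Y (2 * n)" using r by (metis rangeE rangeI)
      have "\<not> a < n" using less a sme by (metis less_irrefl strict_mono_less)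
      moreover have "\<not> b < n" using less b sm by (metis less_irrefl strict_mono_less)
      ultimately have "enumerate Y (2 * n) \<le> enumerate Y (2 * a)" "enumerate X n \<le> enumerate X b"
        using Y inf by simp_all
      then show ?case using a b by simp
    qed
    then show ?thesis by blast
  qed
  have "card ({enumerate X m..<enumerate X (m + 1)} \<inter> Y) \<ge> 2" for m
  proof -
    have "{enumerate Y (2 * m), enumerate Y (2 * m + 1)} \<subseteq> {enumerate X m..<enumerate X (m + 1)} \<inter> Y"
      using Y by (auto simp: en enumerate_in_set simp del: enumerate.simps)
    moreover have "enumerate Y (2 * m) \<noteq> enumerate Y (2 * m + 1)"
      using enumerate_mono[of "2 * m" "2 * m + 1" Y] Y by linarith
    then have "card {enumerate Y (2 * m), enumerate Y (2 * m + 1)} = 2"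
      by simp
    ultimately show ?thesis by (metis card_mono finite_Int finite_atLeastLessThan)
  qed
  then show "\<exists>X\<in>{X. infinite X}. \<exists>\<^sub>\<infinity>i. \<forall>j<2 ^ i.
      card ({enumerate X (2 ^ i + j)..<enumerate X (2 ^ i + j + 1)} \<inter> Y) \<ge> 2"
    using inf by (auto simp: INFM_nat)
qed auto

lemma b_plus_eps:
  shows "\<exists>F. weakly_dominating F \<and> b_plus_eps = |F|"
    and "weakly_dominating G \<Longrightarrow> b_plus_eps \<le>o |G|"
proof -
  let ?R = "{|F| | F. weakly_dominating F}"
  have "\<exists>r\<in>?R. \<forall>r'\<in>?R. r \<le>o r'"
  proof (rule exists_minim_Card_order)
    show "?R \<noteq> {}"
      using weakly_dominating_all_infinite by blast
    show "\<forall>r\<in>?R. Card_order r"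
      by (auto intro: card_of_Card_order)
  qed
  then have "\<exists>\<kappa>. (\<exists>F. weakly_dominating F \<and> \<kappa> = |F| ) \<and>
                 (\<forall>G. weakly_dominating G \<longrightarrow> \<kappa> \<le>o |G| )"
    by blast
  from someI_ex[OF this]
  show "\<exists>F. weakly_dominating F \<and> b_plus_eps = |F|"
    and "weakly_dominating G \<Longrightarrow> b_plus_eps \<le>o |G|"
    unfolding b_plus_eps_def by blast+
qed


section \<open>Laver forcing\<close>

definition laver_tree :: "nat list set \<Rightarrow> bool" where
  "laver_tree T \<longleftrightarrow>
     (\<forall>t\<in>T. \<forall>s. prefix s t \<longrightarrow> s \<in> T) \<and>
     (\<exists>root\<in>T. (\<forall>t\<in>T. prefix root t \<or> prefix t root) \<and>
               (\<forall>t\<in>T. prefix root t \<longrightarrow> infinite {n. t @ [n] \<in> T}))"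

lemma laver_tree_UNIV: "laver_tree UNIV"
  unfolding laver_tree_def by (intro conjI bexI[of _ "[]"]) auto

typedef laver = "{T. laver_tree T}"
  using laver_tree_UNIV by blast

text \<open>Smaller conditions are stronger.\<close>

instantiation laver :: order_top
begin

definition less_eq_laver :: "laver \<Rightarrow> laver \<Rightarrow> bool" where
  "S \<le> T \<longleftrightarrow> Rep_laver S \<subseteq> Rep_laver T"

definition less_laver :: "laver \<Rightarrow> laver \<Rightarrow> bool" where
  "S < T \<longleftrightarrow> Rep_laver S \<subset> Rep_laver T"

definition top_laver :: laver where
  "top_laver = Abs_laver UNIV"

instance
  by standard
     (auto simp: less_eq_laver_def less_laver_def top_laver_def Abs_laver_inverse
        laver_tree_UNIV Rep_laver_inject)

end


section \<open>Names and the forcing relation\<close>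

text \<open>
  A name is a set of pairs of a condition and a name.  Since a datatype cannot recurse through
  unbounded sets, the pairs are indexed (partially, possibly with repetition) by a type \<open>'i\<close>: these
  are exactly the names that are hereditarily of size at most that of \<open>'i\<close>.  The ground model is the
  universe of HOL; letting \<open>'i\<close> range over arbitrarily large types exhausts its names.
\<close>

datatype ('p, 'i) name = Name "'i \<Rightarrow> ('p \<times> ('p, 'i) name) option"

primrec elems :: "('p, 'i) name \<Rightarrow> ('p \<times> ('p, 'i) name) set" where
  "elems (Name f) = ran f"

definition mk_name :: "('p \<times> ('p, 'i) name) set \<Rightarrow> ('p, 'i) name" where
  "mk_name S = (SOME \<tau>. elems \<tau> = S)"

lemma elems_mk_name:
  fixes S :: "('p \<times> ('p, 'i) name) set"
  assumes "S \<lesssim> (UNIV :: 'i set)"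
  shows "elems (mk_name S) = S"
proof -
  obtain g :: "'p \<times> ('p, 'i) name \<Rightarrow> 'i" where g: "inj_on g S"
    using assms by (auto simp: lepoll_def)
  define f where "f i = (if i \<in> g ` S then Some (inv_into S g i) else None)" for i
  have "elems (Name f) = S"
    using g by (auto simp: f_def ran_def inv_into_into split: if_splits)
      (metis imageI inv_into_f_f prod.collapse)
  then show ?thesis unfolding mk_name_def by (rule someI)
qed

definition name_rel :: "('p, 'i) name rel" where
  "name_rel = {(x, a). \<exists>s. (s, x) \<in> elems a}"

lemma wf_name_rel: "wf name_rel"
proof (rule wfUNIVI)
  fix P :: "('p, 'i) name \<Rightarrow> bool" and a
  assume IH: "\<forall>a. (\<forall>x. (x, a) \<in> name_rel \<longrightarrow> P x) \<longrightarrow> P a"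
  show "P a"
  proof (induction a)
    case (Name f)
    have "P x" if "(x, Name f) \<in> name_rel" for x
    proof -
      from that obtain s i where "f i = Some (s, x)"
        by (auto simp: name_rel_def ran_def)
      then show ?thesis
        by (intro Name[of "f i" "(s, x)"]) (auto simp: rangeI intro: range_eqI[of _ _ i])
    qed
    then show ?case using IH by blast
  qed
qed

text \<open>A sentence of the forcing language is identified with the set of conditions forcing it.\<close>

type_synonym 'p sentence = "'p \<Rightarrow> bool"

definition forces :: "'p \<Rightarrow> 'p sentence \<Rightarrow> bool" (infix \<open>\<tturnstile>\<close> 50) where
  "p \<tturnstile> \<phi> \<longleftrightarrow> \<phi> p"

definition forced :: "'p sentence \<Rightarrow> bool" where
  "forced \<phi> \<longleftrightarrow> (\<forall>p. p \<tturnstile> \<phi>)"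

definition dense_below :: "'p::preorder \<Rightarrow> ('p \<Rightarrow> bool) \<Rightarrow> bool" where
  "dense_below p D \<longleftrightarrow> (\<forall>q\<le>p. \<exists>r\<le>q. D r)"

text \<open>
  The usual simultaneous recursion for atomic sentences, with the clause for membership substituted
  into the one for equality; the usual form is recovered in \<open>forces_eq_iff\<close> below.
\<close>

context
  notes conj_cong [fundef_cong]
begin

function forces_eq :: "('p::preorder, 'i) name \<Rightarrow> ('p, 'i) name \<Rightarrow> 'p sentence"
    (infix \<open>\<^bold>=\<close> 50) where
  "(a \<^bold>= b) p \<longleftrightarrow>
     (\<forall>s x. (s, x) \<in> elems a \<longrightarrow> (\<forall>q. q \<le> p \<and> q \<le> s \<longrightarrow>
        dense_below q (\<lambda>r. \<exists>t y. (t, y) \<in> elems b \<and> r \<le> t \<and> (x \<^bold>= y) r))) \<and>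
     (\<forall>t y. (t, y) \<in> elems b \<longrightarrow> (\<forall>q. q \<le> p \<and> q \<le> t \<longrightarrow>
        dense_below q (\<lambda>r. \<exists>s x. (s, x) \<in> elems a \<and> r \<le> s \<and> (x \<^bold>= y) r)))"
  by pat_completeness auto
termination
  by (relation "inv_image name_rel fst") (auto simp: wf_name_rel, auto simp: name_rel_def)

end

declare forces_eq.simps [simp del]

definition forces_mem :: "('p::preorder, 'i) name \<Rightarrow> ('p, 'i) name \<Rightarrow> 'p sentence"
    (infix \<open>\<^bold>\<in>\<close> 50) where
  "(a \<^bold>\<in> b) p \<longleftrightarrow> dense_below p (\<lambda>r. \<exists>t y. (t, y) \<in> elems b \<and> r \<le> t \<and> (a \<^bold>= y) r)"

lemma forces_eq_sym: "(a \<^bold>= b) p \<longleftrightarrow> (b \<^bold>= a) p"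
proof (induction a arbitrary: b p rule: wf_induct_rule[OF wf_name_rel])
  case (1 a)
  then have IH: "(x \<^bold>= y) r \<longleftrightarrow> (y \<^bold>= x) r" if "(s, x) \<in> elems a" for s x y r
    using that by (auto simp: name_rel_def)
  let ?S = "\<lambda>c d. \<forall>s x. (s, x) \<in> elems c \<longrightarrow> (\<forall>q. q \<le> p \<and> q \<le> s \<longrightarrow>
    dense_below q (\<lambda>r. \<exists>t y. (t, y) \<in> elems d \<and> r \<le> t \<and> (x \<^bold>= y) r))"
  let ?S' = "\<lambda>c d. \<forall>s x. (s, x) \<in> elems c \<longrightarrow> (\<forall>q. q \<le> p \<and> q \<le> s \<longrightarrow>
    dense_below q (\<lambda>r. \<exists>t y. (t, y) \<in> elems d \<and> r \<le> t \<and> (y \<^bold>= x) r))"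
  have "?S a b \<longleftrightarrow> ?S' a b"
    by (intro all_cong1 imp_cong refl arg_cong[of _ _ "dense_below _"] ext ex_cong1 conj_cong IH)
  moreover have "?S b a \<longleftrightarrow> ?S' b a"
    by (intro all_cong1 imp_cong refl arg_cong[of _ _ "dense_below _"] ext ex_cong1 conj_cong IH[symmetric])
  moreover have "(a \<^bold>= b) p \<longleftrightarrow> ?S a b \<and> ?S' b a" "(b \<^bold>= a) p \<longleftrightarrow> ?S b a \<and> ?S' a b"
    by (rule forces_eq.simps)+
  ultimately show ?case by argo
qed

lemma forces_eq_iff:
  "(a \<^bold>= b) p \<longleftrightarrow>
     (\<forall>s x. (s, x) \<in> elems a \<longrightarrow> (\<forall>q. q \<le> p \<and> q \<le> s \<longrightarrow> (x \<^bold>\<in> b) q)) \<and>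
     (\<forall>t y. (t, y) \<in> elems b \<longrightarrow> (\<forall>q. q \<le> p \<and> q \<le> t \<longrightarrow> (y \<^bold>\<in> a) q))"
proof -
  have "(\<exists>s x. (s, x) \<in> elems a \<and> r \<le> s \<and> (x \<^bold>= y) r) \<longleftrightarrow>
        (\<exists>s x. (s, x) \<in> elems a \<and> r \<le> s \<and> (y \<^bold>= x) r)" for y r
    using forces_eq_sym by blast
  then show ?thesis
    unfolding forces_mem_def forces_eq.simps[of a b] by simp
qed

definition f_not :: "'p::preorder sentence \<Rightarrow> 'p sentence" (\<open>\<^bold>\<not> _\<close> [40] 40) where
  "(\<^bold>\<not> \<phi>) p \<longleftrightarrow> (\<forall>q\<le>p. \<not> (q \<tturnstile> \<phi>))"

definition f_and :: "'p sentence \<Rightarrow> 'p sentence \<Rightarrow> 'p sentence" (infixr \<open>\<^bold>\<and>\<close> 35) where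
  "(\<phi> \<^bold>\<and> \<psi>) p \<longleftrightarrow> (p \<tturnstile> \<phi>) \<and> (p \<tturnstile> \<psi>)"

definition f_all :: "(('p, 'i) name \<Rightarrow> 'p sentence) \<Rightarrow> 'p sentence" (binder \<open>\<^bold>\<forall>\<close> 10) where
  "(\<^bold>\<forall>x. \<phi> x) p \<longleftrightarrow> (\<forall>x. p \<tturnstile> \<phi> x)"

definition f_or :: "'p::preorder sentence \<Rightarrow> 'p sentence \<Rightarrow> 'p sentence" (infixr \<open>\<^bold>\<or>\<close> 30) where
  "(\<phi> \<^bold>\<or> \<psi>) = (\<^bold>\<not> (\<^bold>\<not> \<phi> \<^bold>\<and> \<^bold>\<not> \<psi>))"

definition f_imp :: "'p::preorder sentence \<Rightarrow> 'p sentence \<Rightarrow> 'p sentence" (infixr \<open>\<^bold>\<longrightarrow>\<close> 25) where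
  "(\<phi> \<^bold>\<longrightarrow> \<psi>) = (\<^bold>\<not> (\<phi> \<^bold>\<and> \<^bold>\<not> \<psi>))"

definition f_iff :: "'p::preorder sentence \<Rightarrow> 'p sentence \<Rightarrow> 'p sentence" (infixr \<open>\<^bold>\<longleftrightarrow>\<close> 25) where
  "(\<phi> \<^bold>\<longleftrightarrow> \<psi>) = ((\<phi> \<^bold>\<longrightarrow> \<psi>) \<^bold>\<and> (\<psi> \<^bold>\<longrightarrow> \<phi>))"

definition f_ex :: "(('p::preorder, 'i) name \<Rightarrow> 'p sentence) \<Rightarrow> 'p sentence" (binder \<open>\<^bold>\<exists>\<close> 10) where
  "(\<^bold>\<exists>x. \<phi> x) = (\<^bold>\<not> (\<^bold>\<forall>x. \<^bold>\<not> \<phi> x))"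


section \<open>Check names of ordinals\<close>

text \<open>
  For a well-order \<open>r\<close>, \<open>ord_check_at r a\<close> is the canonical name of the ordinal (order type) of the
  proper initial segment of \<open>r\<close> below \<open>a\<close>, and \<open>ord_check r\<close> that of the order type of \<open>r\<close>.  They are
  only meaningful if \<open>Field r\<close> injects into the index type of names.
\<close>

definition ord_check_at :: "'k rel \<Rightarrow> 'k \<Rightarrow> ('p::order_top, 'i) name" where
  "ord_check_at r = wfrec (r - Id) (\<lambda>chk a. mk_name {(top, chk b) | b. b \<in> underS r a})"

definition ord_check :: "'k rel \<Rightarrow> ('p::order_top, 'i) name" where
  "ord_check r = mk_name {(top, ord_check_at r b) | b. b \<in> Field r}"

lemma ord_check_at_rec:
  assumes "Well_order r"
  shows "(ord_check_at r a :: ('p::order_top, 'i) name)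
         = mk_name {(top, ord_check_at r b) | b. b \<in> underS r a}"
proof -
  have wf: "wf (r - Id)" using assms by (simp add: well_order_on_def)
  have in_rel: "(b, a) \<in> r - Id" if "b \<in> underS r a" for b
    using that by (auto simp: underS_def)
  let ?F = "\<lambda>chk a. mk_name {(top, chk b) | b. b \<in> underS r a} :: ('p, 'i) name"
  have "wfrec (r - Id) ?F a = ?F (cut (wfrec (r - Id) ?F) (r - Id) a) a"
    by (rule wfrec[OF wf])
  also have "\<dots> = ?F (wfrec (r - Id) ?F) a"
    using in_rel by (intro arg_cong[of _ _ mk_name] Collect_cong ex_cong1 rev_conj_cong) (simp_all add: cut_apply)
  finally show ?thesis unfolding ord_check_at_def .
qed


section \<open>The continuum in the extension\<close>

definition f_subset :: "('p::preorder, 'i) name \<Rightarrow> ('p, 'i) name \<Rightarrow> 'p sentence" (infix \<open>\<^bold>\<subseteq>\<close> 50) where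
  "a \<^bold>\<subseteq> b = (\<^bold>\<forall>x::('p, 'i) name. x \<^bold>\<in> a \<^bold>\<longrightarrow> x \<^bold>\<in> b)"

definition is_empty :: "('p::preorder, 'i) name \<Rightarrow> 'p sentence" where
  "is_empty a = (\<^bold>\<forall>x::('p, 'i) name. \<^bold>\<not> x \<^bold>\<in> a)"

definition is_succ :: "('p::preorder, 'i) name \<Rightarrow> ('p, 'i) name \<Rightarrow> 'p sentence" where
  "is_succ s a = (\<^bold>\<forall>x::('p, 'i) name. x \<^bold>\<in> s \<^bold>\<longleftrightarrow> (x \<^bold>\<in> a \<^bold>\<or> x \<^bold>= a))"

definition is_inductive :: "('p::preorder, 'i) name \<Rightarrow> 'p sentence" where
  "is_inductive a =
     ((\<^bold>\<exists>e::('p, 'i) name. is_empty e \<^bold>\<and> e \<^bold>\<in> a) \<^bold>\<and>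
      (\<^bold>\<forall>x::('p, 'i) name. x \<^bold>\<in> a \<^bold>\<longrightarrow> (\<^bold>\<exists>s::('p, 'i) name. is_succ s x \<^bold>\<and> s \<^bold>\<in> a)))"

definition is_omega :: "('p::preorder, 'i) name \<Rightarrow> 'p sentence" where
  "is_omega w =
     (is_inductive w \<^bold>\<and> (\<^bold>\<forall>v::('p, 'i) name. is_inductive v \<^bold>\<longrightarrow> w \<^bold>\<subseteq> v))"

definition is_powerset :: "('p::preorder, 'i) name \<Rightarrow> ('p, 'i) name \<Rightarrow> 'p sentence" where
  "is_powerset c w = (\<^bold>\<forall>x::('p, 'i) name. x \<^bold>\<in> c \<^bold>\<longleftrightarrow> x \<^bold>\<subseteq> w)"

definition is_upair :: "('p::preorder, 'i) name \<Rightarrow> ('p, 'i) name \<Rightarrow> ('p, 'i) name \<Rightarrow> 'p sentence" where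
  "is_upair z a b = (\<^bold>\<forall>x::('p, 'i) name. x \<^bold>\<in> z \<^bold>\<longleftrightarrow> (x \<^bold>= a \<^bold>\<or> x \<^bold>= b))"

definition is_opair :: "('p::preorder, 'i) name \<Rightarrow> ('p, 'i) name \<Rightarrow> ('p, 'i) name \<Rightarrow> 'p sentence" where
  "is_opair z a b =
     (\<^bold>\<exists>u::('p, 'i) name. \<^bold>\<exists>v::('p, 'i) name. is_upair u a a \<^bold>\<and> is_upair v a b \<^bold>\<and> is_upair z u v)"

definition maps_to ::
    "('p::preorder, 'i) name \<Rightarrow> ('p, 'i) name \<Rightarrow> ('p, 'i) name \<Rightarrow> 'p sentence" where
  "maps_to f x y = (\<^bold>\<exists>z::('p, 'i) name. is_opair z x y \<^bold>\<and> z \<^bold>\<in> f)"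

definition is_bijection ::
    "('p::preorder, 'i) name \<Rightarrow> ('p, 'i) name \<Rightarrow> ('p, 'i) name \<Rightarrow> 'p sentence" where
  "is_bijection f a b =
     ((\<^bold>\<forall>z::('p, 'i) name. z \<^bold>\<in> f \<^bold>\<longrightarrow>
         (\<^bold>\<exists>x::('p, 'i) name. \<^bold>\<exists>y::('p, 'i) name. x \<^bold>\<in> a \<^bold>\<and> y \<^bold>\<in> b \<^bold>\<and> is_opair z x y)) \<^bold>\<and>
      (\<^bold>\<forall>x::('p, 'i) name. x \<^bold>\<in> a \<^bold>\<longrightarrow>
         (\<^bold>\<exists>y::('p, 'i) name. maps_to f x y \<^bold>\<and>
            (\<^bold>\<forall>y'::('p, 'i) name. maps_to f x y' \<^bold>\<longrightarrow> y' \<^bold>= y))) \<^bold>\<and>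
      (\<^bold>\<forall>y::('p, 'i) name. y \<^bold>\<in> b \<^bold>\<longrightarrow>
         (\<^bold>\<exists>x::('p, 'i) name. maps_to f x y \<^bold>\<and>
            (\<^bold>\<forall>x'::('p, 'i) name. maps_to f x' y \<^bold>\<longrightarrow> x' \<^bold>= x))))"

definition equinumerous :: "('p::preorder, 'i) name \<Rightarrow> ('p, 'i) name \<Rightarrow> 'p sentence" where
  "equinumerous a b = (\<^bold>\<exists>f::('p, 'i) name. is_bijection f a b)"

text \<open>The sentence \<open>\<cc> = |\<kappa>|\<close>, where \<open>\<cc> = |P(\<omega>)|\<close> is computed in the extension.\<close>

definition continuum_eq_card :: "('p::preorder, 'i) name \<Rightarrow> 'p sentence" where
  "continuum_eq_card \<kappa> =
     (\<^bold>\<exists>w::('p, 'i) name. \<^bold>\<exists>c::('p, 'i) name.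
        is_omega w \<^bold>\<and> is_powerset c w \<^bold>\<and> equinumerous c \<kappa>)"

end

theory Submission
  imports Defs "HOL-Library.Nat_Bijection"
begin

text \<open>
  Let \<open>F\<close> be a weakly dominating family of size \<open>\<bb>\<^sup>+\<^sup>\<epsilon>\<close>.  For \<open>X \<in> F\<close> the \<open>i\<close>-th block consists of
  \<open>2\<^sup>i\<close> intervals of \<open>X\<close>, one for each 0-1 sequence of length \<open>i\<close>, so each real \<open>f\<close> picks one interval
  per block, and different reals pick almost disjoint unions of intervals.  Hence the generic branch
  takes almost all its values in the union picked by \<open>f\<close> for at most one \<open>f\<close>; this defines in the
  extension a partial map \<open>h\<close> from \<open>F\<close> to the reals of the ground model.  Given a condition \<open>T\<close>, take \<open>Y\<close> so
  sparse that every node of \<open>T\<close> has, from some point on, a successor in each interval of \<open>Y\<close>.  If \<open>X \<in> F\<close>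
  is good for \<open>Y\<close>, then for every \<open>f\<close> the tree \<open>T\<close> can be thinned out to force \<open>h X = f\<close>.  By pure decision
  and fusion, every real of the extension is densely often evaluated from the generic branch by a
  code in the ground model, so \<open>h\<close> followed by evaluation maps \<open>F\<close> onto the reals of the extension.
  As \<open>F\<close> consists of distinct reals, a Cantor--Bernstein argument yields a bijection.
\<close>

section \<open>Forcing calculus\<close>

text \<open>Sentences are arbitrary sets of conditions. The regular ones are the regular open sets
  of the order, the shape taken by the set of conditions forcing a formula.\<close>

definition regular :: "'p::preorder sentence \<Rightarrow> bool" where
  "regular \<phi> \<longleftrightarrow> (\<forall>p q. q \<le> p \<longrightarrow> \<phi> p \<longrightarrow> \<phi> q) \<and> (\<forall>p. dense_below p \<phi> \<longrightarrow> \<phi> p)"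

lemma regular_mono: "regular \<phi> \<Longrightarrow> \<phi> p \<Longrightarrow> q \<le> p \<Longrightarrow> \<phi> q"
  unfolding regular_def by blast

lemma regular_dense: "regular \<phi> \<Longrightarrow> dense_below p \<phi> \<Longrightarrow> \<phi> p"
  unfolding regular_def by blast

lemma dense_below_mono: "dense_below p D \<Longrightarrow> q \<le> p \<Longrightarrow> dense_below q D"
  unfolding dense_below_def by (meson order_trans)

lemma dense_belowI: "(\<And>q. q \<le> p \<Longrightarrow> \<exists>r\<le>q. D r) \<Longrightarrow> dense_below p D"
  unfolding dense_below_def by blast

lemma dense_below_weaken:
  "dense_below p D \<Longrightarrow> (\<And>q. q \<le> p \<Longrightarrow> D q \<Longrightarrow> dense_below q D') \<Longrightarrow> dense_below p D'"
  unfolding dense_below_def by (meson order_refl order_trans)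

lemma dense_below_self: "(\<And>q. q \<le> p \<Longrightarrow> D q) \<Longrightarrow> dense_below p D"
  unfolding dense_below_def by blast

lemma regular_dense_below: "regular (\<lambda>p. dense_below p D)"
  unfolding regular_def using dense_below_mono dense_below_weaken by blast

text \<open>Replaces the choice of a witness in the extension: \<open>\<phi>\<close> only has to be
  proved at conditions from a set, dense below \<open>p\<close>, where the witness is already
  determined.\<close>

lemma regular_by_dense:
  "regular \<phi> \<Longrightarrow> dense_below p D \<Longrightarrow> (\<And>q. q \<le> p \<Longrightarrow> D q \<Longrightarrow> \<phi> q) \<Longrightarrow> \<phi> p"
  by (erule regular_dense, unfold dense_below_def) (meson order_trans)

section \<open>Equality and membership as atomic formulas\<close>

lemma regular_mem: "regular (a \<^bold>\<in> b)"
proof -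
  have "(a \<^bold>\<in> b) = (\<lambda>p. dense_below p (\<lambda>r. \<exists>t y. (t, y) \<in> elems b \<and> r \<le> t \<and> (a \<^bold>= y) r))"
    by (simp add: fun_eq_iff forces_mem_def)
  then show ?thesis by (simp add: regular_dense_below)
qed

lemma regular_eq: "regular (a \<^bold>= b)"
  unfolding regular_def
proof (intro conjI allI impI)
  fix p q assume "q \<le> p" "(a \<^bold>= b) p"
  then show "(a \<^bold>= b) q" unfolding forces_eq_iff by (meson order_trans)
next
  fix p assume d: "dense_below p (a \<^bold>= b)"
  show "(a \<^bold>= b) p"
    unfolding forces_eq_iff
  proof (intro conjI allI impI; elim conjE)
    fix s x q assume x: "(s, x) \<in> elems a" "q \<le> p" "q \<le> s"
    have "dense_below q (a \<^bold>= b)" using d x dense_below_mono by blast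
    then show "(x \<^bold>\<in> b) q"
      by (rule regular_by_dense[OF regular_mem])
        (use x order_trans[of _ q s] in \<open>unfold forces_eq_iff, blast intro: order_refl\<close>)
  next
    fix s x q assume x: "(s, x) \<in> elems b" "q \<le> p" "q \<le> s"
    have "dense_below q (a \<^bold>= b)" using d x dense_below_mono by blast
    then show "(x \<^bold>\<in> a) q"
      by (rule regular_by_dense[OF regular_mem])
        (use x order_trans[of _ q s] in \<open>unfold forces_eq_iff, blast intro: order_refl\<close>)
  qed
qed

lemma forces_eq_mono: "(a \<^bold>= b) p \<Longrightarrow> q \<le> p \<Longrightarrow> (a \<^bold>= b) q"
  using regular_eq regular_mono by blast

lemma forces_mem_mono: "(a \<^bold>\<in> b) p \<Longrightarrow> q \<le> p \<Longrightarrow> (a \<^bold>\<in> b) q"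
  using regular_mem regular_mono by blast

lemma forces_eq_refl: "(a \<^bold>= a) p"
proof (induction a arbitrary: p rule: wf_induct_rule[OF wf_name_rel])
  case (1 a)
  have "(x \<^bold>\<in> a) q" if "(s, x) \<in> elems a" "q \<le> s" for s x q
    unfolding forces_mem_def
  proof (rule dense_below_self)
    fix r assume "r \<le> q"
    moreover have "(x \<^bold>= x) r" using 1 that by (auto simp: name_rel_def)
    ultimately show "\<exists>t y. (t, y) \<in> elems a \<and> r \<le> t \<and> (x \<^bold>= y) r"
      using that order_trans by blast
  qed
  then show ?case unfolding forces_eq_iff by blast
qed

lemma forces_mem_elems: "(s, x) \<in> elems a \<Longrightarrow> p \<le> s \<Longrightarrow> (x \<^bold>\<in> a) p"
  using forces_eq_refl[of a p] unfolding forces_eq_iff by blast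

lemma forces_eq_trans: "(a \<^bold>= b) p \<Longrightarrow> (b \<^bold>= c) p \<Longrightarrow> (a \<^bold>= c) p"
proof (induction a arbitrary: b c p rule: wf_induct_rule[OF wf_name_rel])
  case (1 a)
  have IH: "(x \<^bold>= z) r" if "(s, x) \<in> elems a" "(x \<^bold>= y) r" "(y \<^bold>= z) r" for s x y z r
    by (rule 1(1)[of x y r z]) (use that in \<open>auto simp: name_rel_def\<close>)
  have ab: "(x \<^bold>\<in> b) q" if "(s, x) \<in> elems a" "q \<le> p" "q \<le> s" for s x q
    using 1(2) that unfolding forces_eq_iff by blast
  have ba: "(y \<^bold>\<in> a) q" if "(s, y) \<in> elems b" "q \<le> p" "q \<le> s" for s y q
    using 1(2) that unfolding forces_eq_iff by blast
  have bc: "(x \<^bold>\<in> c) q" if "(s, x) \<in> elems b" "q \<le> p" "q \<le> s" for s x q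
    using 1(3) that unfolding forces_eq_iff by blast
  have cb: "(y \<^bold>\<in> b) q" if "(s, y) \<in> elems c" "q \<le> p" "q \<le> s" for s y q
    using 1(3) that unfolding forces_eq_iff by blast
  show ?case
    unfolding forces_eq_iff
  proof (intro conjI allI impI; elim conjE)
    fix s x q assume x: "(s, x) \<in> elems a" "q \<le> p" "q \<le> s"
    show "(x \<^bold>\<in> c) q"
    proof (rule regular_by_dense[OF regular_mem ab[OF x, unfolded forces_mem_def]])
      fix r assume r: "r \<le> q" "\<exists>t y. (t, y) \<in> elems b \<and> r \<le> t \<and> (x \<^bold>= y) r"
      then obtain t y where y: "(t, y) \<in> elems b" "r \<le> t" "(x \<^bold>= y) r" by blast
      have "(y \<^bold>\<in> c) r" using bc[OF y(1)] y r x order_trans by blast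
      then show "(x \<^bold>\<in> c) r"
        unfolding forces_mem_def
      proof (rule dense_below_weaken)
        fix r' assume r': "r' \<le> r" "\<exists>t z. (t, z) \<in> elems c \<and> r' \<le> t \<and> (y \<^bold>= z) r'"
        then obtain t z where z: "(t, z) \<in> elems c" "r' \<le> t" "(y \<^bold>= z) r'" by blast
        have xz: "(x \<^bold>= z) r'"
          using IH[OF x(1) forces_eq_mono[OF y(3) r'(1)] z(3)] .
        show "dense_below r' (\<lambda>r. \<exists>t z. (t, z) \<in> elems c \<and> r \<le> t \<and> (x \<^bold>= z) r)"
          using z(1) order_trans[OF _ z(2)] forces_eq_mono[OF xz] by (intro dense_below_self) blast
      qed
    qed
  next
    fix u z q assume z: "(u, z) \<in> elems c" "q \<le> p" "q \<le> u"
    show "(z \<^bold>\<in> a) q"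
    proof (rule regular_by_dense[OF regular_mem cb[OF z, unfolded forces_mem_def]])
      fix r assume r: "r \<le> q" "\<exists>t y. (t, y) \<in> elems b \<and> r \<le> t \<and> (z \<^bold>= y) r"
      then obtain t y where y: "(t, y) \<in> elems b" "r \<le> t" "(z \<^bold>= y) r" by blast
      have "(y \<^bold>\<in> a) r" using ba[OF y(1)] y r z order_trans by blast
      then show "(z \<^bold>\<in> a) r"
        unfolding forces_mem_def
      proof (rule dense_below_weaken)
        fix r' assume r': "r' \<le> r" "\<exists>t x. (t, x) \<in> elems a \<and> r' \<le> t \<and> (y \<^bold>= x) r'"
        then obtain t x where x: "(t, x) \<in> elems a" "r' \<le> t" "(y \<^bold>= x) r'" by blast
        \<comment> \<open>The induction hypothesis only treats equations with an element of
          \<open>a\<close> on the left, so the chain from \<open>z\<close> over \<open>y\<close> to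
          \<open>x\<close> is reversed first.\<close>
        have "(x \<^bold>= y) r'" "(y \<^bold>= z) r'"
          using x(3) forces_eq_mono[OF y(3) r'(1)] forces_eq_sym by blast+
        then have zx: "(z \<^bold>= x) r'"
          using IH[OF x(1)] forces_eq_sym by blast
        show "dense_below r' (\<lambda>r. \<exists>t x. (t, x) \<in> elems a \<and> r \<le> t \<and> (z \<^bold>= x) r)"
          using x(1) order_trans[OF _ x(2)] forces_eq_mono[OF zx] by (intro dense_below_self) blast
      qed
    qed
  qed
qed

lemma forces_mem_cong_left: "(x \<^bold>\<in> a) p \<Longrightarrow> (x \<^bold>= y) p \<Longrightarrow> (y \<^bold>\<in> a) p"
proof (rule regular_by_dense[OF regular_mem, of p])
  assume "(x \<^bold>\<in> a) p"
  then show "dense_below p (\<lambda>r. \<exists>t z. (t, z) \<in> elems a \<and> r \<le> t \<and> (x \<^bold>= z) r)"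
    unfolding forces_mem_def .
next
  fix q assume q: "(x \<^bold>= y) p" "q \<le> p" "\<exists>t z. (t, z) \<in> elems a \<and> q \<le> t \<and> (x \<^bold>= z) q"
  then obtain t z where z: "(t, z) \<in> elems a" "q \<le> t" "(x \<^bold>= z) q" by blast
  have "(y \<^bold>= x) q" using q(1,2) forces_eq_mono forces_eq_sym by blast
  then have *: "(y \<^bold>= z) q" using z(3) forces_eq_trans by blast
  show "(y \<^bold>\<in> a) q"
    unfolding forces_mem_def
  proof (rule dense_below_self)
    fix r assume "r \<le> q"
    then show "\<exists>t z. (t, z) \<in> elems a \<and> r \<le> t \<and> (y \<^bold>= z) r"
      using z(1,2) forces_eq_mono[OF *] order_trans by blast
  qed
qed

lemma forces_mem_cong_right: "(x \<^bold>\<in> a) p \<Longrightarrow> (a \<^bold>= b) p \<Longrightarrow> (x \<^bold>\<in> b) p"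
proof (rule regular_by_dense[OF regular_mem, of p])
  assume "(x \<^bold>\<in> a) p"
  then show "dense_below p (\<lambda>r. \<exists>t y. (t, y) \<in> elems a \<and> r \<le> t \<and> (x \<^bold>= y) r)"
    unfolding forces_mem_def .
next
  fix q assume "(a \<^bold>= b) p" "q \<le> p" "\<exists>t y. (t, y) \<in> elems a \<and> q \<le> t \<and> (x \<^bold>= y) q"
  then obtain t y where "(y \<^bold>\<in> b) q" "(x \<^bold>= y) q"
    unfolding forces_eq_iff by blast
  then show "(x \<^bold>\<in> b) q" using forces_mem_cong_left forces_eq_sym by blast
qed

lemma forces_eq_ext:
  assumes "\<And>x q. q \<le> p \<Longrightarrow> (x \<^bold>\<in> a) q \<longleftrightarrow> (x \<^bold>\<in> b) q"
  shows "(a \<^bold>= b) p"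
  using assms forces_mem_elems unfolding forces_eq_iff by blast

lemma forces_eq_ext_iff:
  "(a \<^bold>= b) p \<longleftrightarrow> (\<forall>x. \<forall>q\<le>p. (x \<^bold>\<in> a) q \<longleftrightarrow> (x \<^bold>\<in> b) q)"
  by (meson forces_eq_ext forces_eq_mono forces_eq_sym forces_mem_cong_right)

section \<open>Connectives and quantifiers\<close>

lemma regular_not: "regular \<phi> \<Longrightarrow> regular (\<^bold>\<not> \<phi>)"
  unfolding regular_def f_not_def forces_def dense_below_def by (meson order_refl order_trans)

lemma regular_and: "regular \<phi> \<Longrightarrow> regular \<psi> \<Longrightarrow> regular (\<phi> \<^bold>\<and> \<psi>)"
  unfolding regular_def f_and_def forces_def dense_below_def by meson

lemma regular_all: "(\<And>x. regular (\<phi> x)) \<Longrightarrow> regular (\<^bold>\<forall>x. \<phi> x)"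
  unfolding regular_def f_all_def forces_def dense_below_def by meson

lemma regular_or: "regular \<phi> \<Longrightarrow> regular \<psi> \<Longrightarrow> regular (\<phi> \<^bold>\<or> \<psi>)"
  unfolding f_or_def by (intro regular_not regular_and)

lemma regular_imp: "regular \<phi> \<Longrightarrow> regular \<psi> \<Longrightarrow> regular (\<phi> \<^bold>\<longrightarrow> \<psi>)"
  unfolding f_imp_def by (intro regular_not regular_and)

lemma regular_iff: "regular \<phi> \<Longrightarrow> regular \<psi> \<Longrightarrow> regular (\<phi> \<^bold>\<longleftrightarrow> \<psi>)"
  unfolding f_iff_def by (intro regular_imp regular_and)

lemma regular_ex: "(\<And>x. regular (\<phi> x)) \<Longrightarrow> regular (\<^bold>\<exists>x. \<phi> x)"
  unfolding f_ex_def by (intro regular_not regular_all)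

lemmas regular_intros =
  regular_eq regular_mem regular_not regular_and regular_all regular_or regular_imp regular_iff
  regular_ex

lemma and_iff: "(\<phi> \<^bold>\<and> \<psi>) p \<longleftrightarrow> \<phi> p \<and> \<psi> p"
  by (simp add: f_and_def forces_def)

lemma all_iff: "(\<^bold>\<forall>x. \<phi> x) p \<longleftrightarrow> (\<forall>x. \<phi> x p)"
  by (simp add: f_all_def forces_def)

lemma not_iff: "(\<^bold>\<not> \<phi>) p \<longleftrightarrow> (\<forall>q\<le>p. \<not> \<phi> q)"
  by (simp add: f_not_def forces_def)

lemma imp_iff:
  assumes "regular \<phi>" "regular \<psi>"
  shows "(\<phi> \<^bold>\<longrightarrow> \<psi>) p \<longleftrightarrow> (\<forall>q\<le>p. \<phi> q \<longrightarrow> \<psi> q)"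
proof -
  have "(\<phi> \<^bold>\<longrightarrow> \<psi>) p \<longleftrightarrow> (\<forall>q\<le>p. \<phi> q \<longrightarrow> \<not> (\<forall>r\<le>q. \<not> \<psi> r))"
    by (simp add: f_imp_def not_iff and_iff)
  \<comment> \<open>Unfolding gives \<open>\<psi>\<close> only densely below \<open>q\<close>;
    regularity of \<open>\<psi>\<close> moves it to \<open>q\<close> itself.\<close>
  moreover have "\<psi> q" if "\<forall>q\<le>p. \<phi> q \<longrightarrow> \<not> (\<forall>r\<le>q. \<not> \<psi> r)" "q \<le> p" "\<phi> q" for q
  proof (rule regular_dense[OF assms(2)], rule dense_belowI)
    fix r assume "r \<le> q"
    then have "\<phi> r" "r \<le> p" using that(2) regular_mono[OF assms(1) that(3)] order_trans by blast+
    then show "\<exists>s\<le>r. \<psi> s" using that(1) by blast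
  qed
  moreover have "\<not> (\<forall>r\<le>q. \<not> \<psi> r)" if "\<forall>q\<le>p. \<phi> q \<longrightarrow> \<psi> q" "q \<le> p" "\<phi> q" for q
    using that order_refl[of q] by blast
  ultimately show ?thesis by blast
qed

lemma iff_iff:
  assumes "regular \<phi>" "regular \<psi>"
  shows "(\<phi> \<^bold>\<longleftrightarrow> \<psi>) p \<longleftrightarrow> (\<forall>q\<le>p. \<phi> q \<longleftrightarrow> \<psi> q)"
  using assms by (auto simp: f_iff_def and_iff imp_iff)

lemma or_iff: "(\<phi> \<^bold>\<or> \<psi>) p \<longleftrightarrow> dense_below p (\<lambda>q. \<phi> q \<or> \<psi> q)"
proof
  assume a: "(\<phi> \<^bold>\<or> \<psi>) p"
  show "dense_below p (\<lambda>q. \<phi> q \<or> \<psi> q)"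
  proof (rule dense_belowI)
    fix q assume "q \<le> p"
    then have "\<not> ((\<forall>r\<le>q. \<not> \<phi> r) \<and> (\<forall>r\<le>q. \<not> \<psi> r))"
      using a unfolding f_or_def not_iff and_iff by blast
    then show "\<exists>r\<le>q. \<phi> r \<or> \<psi> r" by blast
  qed
next
  assume "dense_below p (\<lambda>q. \<phi> q \<or> \<psi> q)"
  then show "(\<phi> \<^bold>\<or> \<psi>) p"
    unfolding f_or_def not_iff and_iff dense_below_def by blast
qed

lemma ex_iff: "(\<^bold>\<exists>x. \<phi> x) p \<longleftrightarrow> dense_below p (\<lambda>q. \<exists>x. \<phi> x q)"
  unfolding f_ex_def not_iff all_iff dense_below_def by (simp, blast)

lemma and_forcesI: "\<phi> p \<Longrightarrow> \<psi> p \<Longrightarrow> (\<phi> \<^bold>\<and> \<psi>) p"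
  by (simp add: and_iff)

lemma all_forcesI: "(\<And>x. \<phi> x p) \<Longrightarrow> (\<^bold>\<forall>x. \<phi> x) p"
  by (simp add: all_iff)

lemma imp_forcesI:
  "regular \<phi> \<Longrightarrow> regular \<psi> \<Longrightarrow> (\<And>q. q \<le> p \<Longrightarrow> \<phi> q \<Longrightarrow> \<psi> q) \<Longrightarrow> (\<phi> \<^bold>\<longrightarrow> \<psi>) p"
  by (simp add: imp_iff)

lemma exI_forces: "regular (\<phi> x) \<Longrightarrow> \<phi> x p \<Longrightarrow> (\<^bold>\<exists>x. \<phi> x) p"
  unfolding ex_iff by (rule dense_below_self) (use regular_mono[of "\<phi> x" p] in blast)

section \<open>Names for pairs, ordinals and bijections\<close>

text \<open>As for \<open>mk_name\<close>, the result is meaningful only if \<open>Z\<close> injects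
  into the index type.\<close>

definition name_of_set :: "('p::order_top, 'i) name set \<Rightarrow> ('p, 'i) name" where
  "name_of_set Z = mk_name {(top, z) | z. z \<in> Z}"

definition upair :: "('p::order_top, 'i) name \<Rightarrow> ('p, 'i) name \<Rightarrow> ('p, 'i) name" where
  "upair a b = name_of_set {a, b}"

definition opair :: "('p::order_top, 'i) name \<Rightarrow> ('p, 'i) name \<Rightarrow> ('p, 'i) name" where
  "opair a b = upair (upair a a) (upair a b)"

lemma elems_name_of_set:
  assumes "(Z :: ('p::order_top, 'i) name set) \<lesssim> (UNIV :: 'i set)"
  shows "elems (name_of_set Z) = {(top, z) | z. z \<in> Z}"
proof -
  have "{(top :: 'p, z) | z. z \<in> Z} = Pair top ` Z" by auto
  then have "{(top :: 'p, z) | z. z \<in> Z} \<lesssim> (UNIV :: 'i set)"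
    using assms image_lepoll lepoll_trans by metis
  then show ?thesis unfolding name_of_set_def by (rule elems_mk_name)
qed

lemma mem_name_of_set:
  assumes "(Z :: ('p::order_top, 'i) name set) \<lesssim> (UNIV :: 'i set)"
  shows "(x \<^bold>\<in> name_of_set Z) p \<longleftrightarrow> dense_below p (\<lambda>q. \<exists>z\<in>Z. (x \<^bold>= z) q)"
  unfolding forces_mem_def elems_name_of_set[OF assms] by (simp add: Bex_def conj_commute)

lemma mem_name_of_setI:
  assumes "(Z :: ('p::order_top, 'i) name set) \<lesssim> (UNIV :: 'i set)" "z \<in> Z"
  shows "(z \<^bold>\<in> name_of_set Z) p"
  unfolding mem_name_of_set[OF assms(1)] using assms(2) forces_eq_refl
  by (intro dense_below_self) blast

text \<open>Laver conditions and codes of reals can be coded by sets of natural numbers, so an index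
  type of at least the size of the continuum has room for every name in the argument, including
  those for the power set of \<omega> and for the bijection.\<close>

context
  assumes continuum_le: "(UNIV :: nat set set) \<lesssim> (UNIV :: 'i set)"
begin

lemma countable_lepoll: "countable X \<Longrightarrow> X \<lesssim> (UNIV :: 'i set)"
proof -
  assume "countable X"
  then have "X \<lesssim> (UNIV :: nat set)"
    unfolding countable_def lepoll_def by blast
  also have "\<dots> \<lesssim> (UNIV :: nat set set)"
    unfolding lepoll_def by (rule exI[of _ "\<lambda>n. {n}"]) simp
  finally show ?thesis using continuum_le lepoll_trans by blast
qed

section \<open>Unordered and ordered pairs\<close>

lemma upair_lepoll: "{a, b} \<lesssim> (UNIV :: 'i set)"
  by (rule countable_lepoll) simp

lemma mem_upair:
  "(x \<^bold>\<in> upair a (b :: ('p::order_top, 'i) name)) p \<longleftrightarrow> dense_below p (\<lambda>q. (x \<^bold>= a) q \<or> (x \<^bold>= b) q)"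
  unfolding upair_def mem_name_of_set[OF upair_lepoll] by simp

lemma mem_upair_left: "(a \<^bold>\<in> upair a (b :: ('p::order_top, 'i) name)) p"
  and mem_upair_right: "(b \<^bold>\<in> upair a (b :: ('p::order_top, 'i) name)) p"
  unfolding upair_def by (rule mem_name_of_setI[OF upair_lepoll]; simp)+

lemma mem_upair_cases:
  fixes a b :: "('p::order_top, 'i) name"
  assumes "(x \<^bold>\<in> upair a b) p" "regular \<phi>"
    and "\<And>q. q \<le> p \<Longrightarrow> (x \<^bold>= a) q \<Longrightarrow> \<phi> q"
    and "\<And>q. q \<le> p \<Longrightarrow> (x \<^bold>= b) q \<Longrightarrow> \<phi> q"
  shows "\<phi> p"
  by (rule regular_by_dense[OF assms(2) assms(1)[unfolded mem_upair]]) (use assms(3,4) in blast)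

lemma upair_cong:
  fixes a b a' b' :: "('p::order_top, 'i) name"
  assumes "(a \<^bold>= a') p" "(b \<^bold>= b') p"
  shows "(upair a b \<^bold>= upair a' b') p"
proof -
  have sub: "(x \<^bold>\<in> upair c' d') q"
    if "(x \<^bold>\<in> upair c d) q" "(c \<^bold>= c') q" "(d \<^bold>= d') q" for c d c' d' x :: "('p, 'i) name" and q
  proof (rule mem_upair_cases[OF that(1) regular_mem])
    fix r assume "r \<le> q" "(x \<^bold>= c) r"
    then show "(x \<^bold>\<in> upair c' d') r"
      using mem_upair_left[of c' d' r] forces_mem_cong_left forces_eq_mono[OF that(2)]
        forces_eq_sym forces_eq_trans by blast
  next
    fix r assume "r \<le> q" "(x \<^bold>= d) r"
    then show "(x \<^bold>\<in> upair c' d') r"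
      using mem_upair_right[of d' c' r] forces_mem_cong_left forces_eq_mono[OF that(3)]
        forces_eq_sym forces_eq_trans by blast
  qed
  show ?thesis
  proof (rule forces_eq_ext)
    fix x q assume q: "q \<le> p"
    have "(a \<^bold>= a') q" "(b \<^bold>= b') q" using assms q forces_eq_mono by blast+
    moreover from this have "(a' \<^bold>= a) q" "(b' \<^bold>= b) q" using forces_eq_sym by blast+
    ultimately show "(x \<^bold>\<in> upair a b) q \<longleftrightarrow> (x \<^bold>\<in> upair a' b') q" using sub by blast
  qed
qed

lemma opair_cong:
  fixes a b a' b' :: "('p::order_top, 'i) name"
  assumes "(a \<^bold>= a') p" "(b \<^bold>= b') p"
  shows "(opair a b \<^bold>= opair a' b') p"
  unfolding opair_def by (intro upair_cong assms)

lemma singleton_eq_upairD: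
  fixes a c d :: "('p::order_top, 'i) name"
  assumes "(upair a a \<^bold>= upair c d) p"
  shows "(c \<^bold>= a) p" "(d \<^bold>= a) p"
proof -
  have eq: "(upair c d \<^bold>= upair a a) p" using assms forces_eq_sym by blast
  show "(c \<^bold>= a) p"
    by (rule mem_upair_cases[OF forces_mem_cong_right[OF mem_upair_left eq] regular_eq])
  show "(d \<^bold>= a) p"
    by (rule mem_upair_cases[OF forces_mem_cong_right[OF mem_upair_right eq] regular_eq])
qed

lemma opair_eqD1:
  fixes a b c d :: "('p::order_top, 'i) name"
  assumes "(opair a b \<^bold>= opair c d) p"
  shows "(a \<^bold>= c) p"
proof (rule mem_upair_cases[OF _ regular_eq])
  show "(upair a a \<^bold>\<in> upair (upair c c) (upair c d)) p"
    using forces_mem_cong_right[OF mem_upair_left assms[unfolded opair_def]] .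
qed (use singleton_eq_upairD forces_eq_sym in blast)+

lemma opair_eqD2:
  fixes a b c d :: "('p::order_top, 'i) name"
  assumes "(opair a b \<^bold>= opair c d) p"
  shows "(b \<^bold>= d) p"
proof -
  have ac: "(a \<^bold>= c) q" if "q \<le> p" for q
    using opair_eqD1[OF forces_eq_mono[OF assms that]] .
  have cd_in: "(upair c d \<^bold>\<in> upair (upair a a) (upair a b)) p"
    using forces_mem_cong_right[OF mem_upair_right assms[unfolded opair_def, THEN forces_eq_sym[THEN iffD1]]] .
  have ab_in: "(upair a b \<^bold>\<in> upair (upair c c) (upair c d)) q" if "q \<le> p" for q
    using forces_mem_cong_right[OF mem_upair_right forces_eq_mono[OF assms that, unfolded opair_def]] .
  \<comment> \<open>The main case, where \<open>{a, b}\<close> and \<open>{c, d}\<close> agree: if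
    \<open>b\<close> equals \<open>c\<close>, then \<open>d\<close> is \<open>b\<close>, or it is
    \<open>a\<close>, which equals \<open>c\<close> and hence \<open>b\<close>.\<close>
  have ab_cd: "(b \<^bold>= d) q" if q: "q \<le> p" and eq: "(upair a b \<^bold>= upair c d) q" for q
  proof (rule mem_upair_cases[OF forces_mem_cong_right[OF mem_upair_right eq] regular_eq])
    fix r assume r: "r \<le> q" "(b \<^bold>= c) r"
    have eq': "(upair c d \<^bold>= upair a b) r"
      using forces_eq_mono[OF eq r(1)] forces_eq_sym by blast
    show "(b \<^bold>= d) r"
    proof (rule mem_upair_cases[OF forces_mem_cong_right[OF mem_upair_right eq'] regular_eq])
      fix s assume s: "s \<le> r" "(d \<^bold>= a) s"
      have "(a \<^bold>= c) s" "(b \<^bold>= c) s"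
        using ac[OF order_trans[OF s(1) order_trans[OF r(1) q]]] forces_eq_mono[OF r(2) s(1)] by blast+
      then show "(b \<^bold>= d) s" using s(2) forces_eq_sym forces_eq_trans by blast
    qed (use forces_eq_sym in blast)
  qed
  show ?thesis
  proof (rule mem_upair_cases[OF cd_in regular_eq])
    fix q assume q: "q \<le> p" "(upair c d \<^bold>= upair a a) q"
    then have da: "(d \<^bold>= a) q" using singleton_eq_upairD(2) forces_eq_sym by blast
    show "(b \<^bold>= d) q"
    proof (rule mem_upair_cases[OF ab_in[OF q(1)] regular_eq])
      fix r assume r: "r \<le> q" "(upair a b \<^bold>= upair c c) r"
      then have "(b \<^bold>= c) r" using singleton_eq_upairD(2) forces_eq_sym by blast
      moreover have "(a \<^bold>= c) r" "(d \<^bold>= a) r"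
        using ac[OF order_trans[OF r(1) q(1)]] forces_eq_mono[OF da r(1)] by blast+
      ultimately show "(b \<^bold>= d) r" using forces_eq_sym forces_eq_trans by blast
    next
      fix r assume "r \<le> q" "(upair a b \<^bold>= upair c d) r"
      then show "(b \<^bold>= d) r" using ab_cd[OF order_trans[OF _ q(1)]] by blast
    qed
  next
    fix q assume "q \<le> p" "(upair c d \<^bold>= upair a b) q"
    then show "(b \<^bold>= d) q" using ab_cd forces_eq_sym by blast
  qed
qed

lemma is_upair_iff: "is_upair z a (b :: ('p::order_top, 'i) name) p \<longleftrightarrow> (z \<^bold>= upair a b) p"
  unfolding is_upair_def all_iff forces_eq_ext_iff[of z] mem_upair
    iff_iff[OF regular_mem regular_or[OF regular_eq regular_eq]] or_iff ..

lemma is_opair_iff: "is_opair z a (b :: ('p::order_top, 'i) name) p \<longleftrightarrow> (z \<^bold>= opair a b) p"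
proof
  assume *: "is_opair z a b p"
  show "(z \<^bold>= opair a b) p"
  proof (rule regular_by_dense[OF regular_eq *[unfolded is_opair_def ex_iff]], elim exE)
    fix q u
    assume "dense_below q
       (\<lambda>q. \<exists>v. (is_upair u a a \<^bold>\<and> is_upair v a b \<^bold>\<and> is_upair z u v) q)"
    then show "(z \<^bold>= opair a b) q"
      by (rule regular_by_dense[OF regular_eq])
        (unfold and_iff is_upair_iff opair_def, use upair_cong forces_eq_trans in blast)
  qed
next
  assume *: "(z \<^bold>= opair a b) p"
  have "(is_upair (upair a a) a a \<^bold>\<and> is_upair (upair a b) a b \<^bold>\<and> is_upair z (upair a a) (upair a b)) q"
    if "q \<le> p" for q
    unfolding and_iff is_upair_iff using forces_eq_mono[OF * that] forces_eq_refl opair_def by metis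
  then show "is_opair z a b p"
    unfolding is_opair_def ex_iff by (intro dense_below_self exI) (blast intro: order_trans)
qed

lemma is_opair_eq: "is_opair z a (b :: ('p::order_top, 'i) name) = (z \<^bold>= opair a b)"
  by (rule ext) (rule is_opair_iff)

lemma maps_to_iff: "maps_to f x (y :: ('p::order_top, 'i) name) p \<longleftrightarrow> (opair x y \<^bold>\<in> f) p"
proof
  assume *: "maps_to f x y p"
  show "(opair x y \<^bold>\<in> f) p"
    by (rule regular_by_dense[OF regular_mem *[unfolded maps_to_def ex_iff]])
      (unfold and_iff is_opair_iff, use forces_mem_cong_left in blast)
next
  assume *: "(opair x y \<^bold>\<in> f) p"
  show "maps_to f x y p"
    unfolding maps_to_def ex_iff and_iff is_opair_iff
    by (intro dense_below_self exI[of _ "opair x y"] conjI forces_eq_refl forces_mem_mono[OF *])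
qed

lemma maps_to_eq: "maps_to f x (y :: ('p::order_top, 'i) name) = (opair x y \<^bold>\<in> f)"
  by (rule ext) (rule maps_to_iff)

text \<open>Here \<open>B C \<alpha> p\<close> means that \<open>p\<close> forces the element coded
  by \<open>C\<close> to be matched with \<open>\<alpha>\<close>. Codes count only up to forced
  equality of their names, while members of \<open>A\<close> keep their identity by
  \<open>k_inj\<close>. Partners are asked for only densely; the graph lists each pair with every
  condition that forces the match.\<close>

lemma is_bijectionI:
  fixes y :: "'c \<Rightarrow> ('p::order_top, 'i) name" and k :: "'k \<Rightarrow> ('p, 'i) name"
  assumes range_y: "range y \<lesssim> (UNIV :: 'i set)" and image_k: "k ` A \<lesssim> (UNIV :: 'i set)"
    and graph: "{(p, opair (y C) (k \<alpha>)) | p C \<alpha>. \<alpha> \<in> A \<and> B C \<alpha> p} \<lesssim> (UNIV :: 'i set)"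
    and k_inj: "\<And>\<alpha> \<beta> p. \<alpha> \<in> A \<Longrightarrow> \<beta> \<in> A \<Longrightarrow> (k \<alpha> \<^bold>= k \<beta>) p \<Longrightarrow> \<alpha> = \<beta>"
    and B_mono: "\<And>C \<alpha> p q. B C \<alpha> p \<Longrightarrow> q \<le> p \<Longrightarrow> B C \<alpha> q"
    and B_cong: "\<And>C C' \<alpha> p. B C \<alpha> p \<Longrightarrow> (y C \<^bold>= y C') p \<Longrightarrow> B C' \<alpha> p"
    and B_total: "\<And>\<alpha> p. \<alpha> \<in> A \<Longrightarrow> \<exists>q\<le>p. \<exists>C. B C \<alpha> q"
    and B_fun: "\<And>\<alpha> C C' p. \<alpha> \<in> A \<Longrightarrow> B C \<alpha> p \<Longrightarrow> B C' \<alpha> p \<Longrightarrow> (y C \<^bold>= y C') p"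
    and B_surj: "\<And>C p. \<exists>q\<le>p. \<exists>\<alpha>\<in>A. B C \<alpha> q"
    and B_inj: "\<And>C \<alpha> \<beta> p. \<alpha> \<in> A \<Longrightarrow> \<beta> \<in> A \<Longrightarrow> B C \<alpha> p \<Longrightarrow> B C \<beta> p \<Longrightarrow> \<alpha> = \<beta>"
  shows "is_bijection (mk_name {(p, opair (y C) (k \<alpha>)) | p C \<alpha>. \<alpha> \<in> A \<and> B C \<alpha> p})
    (name_of_set (range y)) (name_of_set (k ` A)) p"
proof -
  let ?F = "mk_name {(p, opair (y C) (k \<alpha>)) | p C \<alpha>. \<alpha> \<in> A \<and> B C \<alpha> p}"
  \<comment> \<open>A member of the graph is found at a condition below one that the graph lists;
    \<open>B_mono\<close> transfers the match to it.\<close>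
  have FD: "dense_below q (\<lambda>r. \<exists>C \<alpha>. \<alpha> \<in> A \<and> B C \<alpha> r \<and> (z \<^bold>= opair (y C) (k \<alpha>)) r)"
    if "(z \<^bold>\<in> ?F) q" for z q
    using that unfolding forces_mem_def elems_mk_name[OF graph]
    by (rule dense_below_weaken)
      (intro dense_below_self, use B_mono forces_eq_mono order_trans in blast)
  have FI: "(opair (y C) (k \<alpha>) \<^bold>\<in> ?F) q" if "\<alpha> \<in> A" "B C \<alpha> q" for C \<alpha> q
    by (rule forces_mem_elems[of q]) (use that elems_mk_name[OF graph] in auto)
  have FD2: "dense_below q (\<lambda>r. \<exists>C \<alpha>. \<alpha> \<in> A \<and> B C \<alpha> r \<and> (u \<^bold>= y C) r \<and> (v \<^bold>= k \<alpha>) r)"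
    if "(opair u v \<^bold>\<in> ?F) q" for u v q
    using FD[OF that]
    by (rule dense_below_weaken)
      (intro dense_below_self, use B_mono forces_eq_mono opair_eqD1 opair_eqD2 in blast)
  have mem_k: "(k \<alpha> \<^bold>\<in> name_of_set (k ` A)) q" if "\<alpha> \<in> A" for \<alpha> q
    using that by (intro mem_name_of_setI[OF image_k]) simp
  have mem_y: "(y C \<^bold>\<in> name_of_set (range y)) q" for C q
    by (intro mem_name_of_setI[OF range_y]) simp
  show ?thesis
    unfolding is_bijection_def is_opair_eq maps_to_eq
  proof (intro and_forcesI)
    show "(\<^bold>\<forall>z. z \<^bold>\<in> ?F \<^bold>\<longrightarrow> (\<^bold>\<exists>x. \<^bold>\<exists>v. x \<^bold>\<in> name_of_set (range y) \<^bold>\<and>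
      v \<^bold>\<in> name_of_set (k ` A) \<^bold>\<and> z \<^bold>= opair x v)) p"
    proof (intro all_forcesI imp_forcesI regular_intros)
      fix z q assume "(z \<^bold>\<in> ?F) q"
      from FD[OF this]
      show "(\<^bold>\<exists>x. \<^bold>\<exists>v. x \<^bold>\<in> name_of_set (range y) \<^bold>\<and> v \<^bold>\<in> name_of_set (k ` A) \<^bold>\<and> z \<^bold>= opair x v) q"
      proof (rule regular_by_dense[rotated])
        fix r assume "\<exists>C \<alpha>. \<alpha> \<in> A \<and> B C \<alpha> r \<and> (z \<^bold>= opair (y C) (k \<alpha>)) r"
        then obtain C \<alpha> where "\<alpha> \<in> A" "(z \<^bold>= opair (y C) (k \<alpha>)) r" by blast
        then show "(\<^bold>\<exists>x. \<^bold>\<exists>v. x \<^bold>\<in> name_of_set (range y) \<^bold>\<and> v \<^bold>\<in> name_of_set (k ` A) \<^bold>\<and> z \<^bold>= opair x v) r"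
          by (intro exI_forces[where x = "y C"] exI_forces[where x = "k \<alpha>"]
              regular_intros and_forcesI mem_y mem_k)
      qed (intro regular_intros)
    qed
  next
    show "(\<^bold>\<forall>x. x \<^bold>\<in> name_of_set (range y) \<^bold>\<longrightarrow> (\<^bold>\<exists>v. opair x v \<^bold>\<in> ?F \<^bold>\<and>
       (\<^bold>\<forall>y'. opair x y' \<^bold>\<in> ?F \<^bold>\<longrightarrow> y' \<^bold>= v))) p"
    proof (intro all_forcesI imp_forcesI regular_intros)
      fix x q assume "(x \<^bold>\<in> name_of_set (range y)) q"
      then have x: "dense_below q (\<lambda>q. \<exists>z\<in>range y. (x \<^bold>= z) q)"
        unfolding mem_name_of_set[OF range_y] .
      show "(\<^bold>\<exists>v. opair x v \<^bold>\<in> ?F \<^bold>\<and> (\<^bold>\<forall>y'. opair x y' \<^bold>\<in> ?F \<^bold>\<longrightarrow> y' \<^bold>= v)) q"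
      proof (rule regular_dense, intro regular_intros, rule dense_belowI)
        fix q' assume "q' \<le> q"
        then obtain r C where r: "r \<le> q'" "(x \<^bold>= y C) r"
          using x unfolding dense_below_def by blast
        obtain s \<alpha> where s: "s \<le> r" "\<alpha> \<in> A" "B C \<alpha> s" using B_surj by blast
        have xs: "(x \<^bold>= y C) s" using r(2) s(1) forces_eq_mono by blast
        have "(opair x (k \<alpha>) \<^bold>\<in> ?F) s"
          using forces_mem_cong_left[OF FI[OF s(2,3)]] opair_cong[OF xs forces_eq_refl] forces_eq_sym
          by blast
        moreover have "(\<^bold>\<forall>y'. opair x y' \<^bold>\<in> ?F \<^bold>\<longrightarrow> y' \<^bold>= k \<alpha>) s"
        proof (intro all_forcesI imp_forcesI regular_intros)
          fix y' t assume t: "t \<le> s" "(opair x y' \<^bold>\<in> ?F) t"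
          show "(y' \<^bold>= k \<alpha>) t"
          proof (rule regular_by_dense[OF regular_eq FD2[OF t(2)]])
            fix u assume u: "u \<le> t" "\<exists>C \<alpha>. \<alpha> \<in> A \<and> B C \<alpha> u \<and> (x \<^bold>= y C) u \<and> (y' \<^bold>= k \<alpha>) u"
            then obtain C' \<beta> where b: "\<beta> \<in> A" "B C' \<beta> u" "(x \<^bold>= y C') u" "(y' \<^bold>= k \<beta>) u" by blast
            have "u \<le> s" using t(1) u(1) order_trans by blast
            then have "(x \<^bold>= y C) u" "B C \<alpha> u" using xs s(3) forces_eq_mono B_mono by blast+
            moreover from this have "(y C' \<^bold>= y C) u"
              using b(3) forces_eq_sym forces_eq_trans by blast
            then have "B C \<beta> u" using b(2) B_cong by blast
            ultimately have "\<alpha> = \<beta>" using B_inj s(2) b(1) by blast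
            then show "(y' \<^bold>= k \<alpha>) u" using b(4) by simp
          qed
        qed
        ultimately have "(\<^bold>\<exists>v. opair x v \<^bold>\<in> ?F \<^bold>\<and> (\<^bold>\<forall>y'. opair x y' \<^bold>\<in> ?F \<^bold>\<longrightarrow> y' \<^bold>= v)) s"
          by (intro exI_forces[where x = "k \<alpha>"] regular_intros and_forcesI)
        then show "\<exists>s\<le>q'. (\<^bold>\<exists>v. opair x v \<^bold>\<in> ?F \<^bold>\<and> (\<^bold>\<forall>y'. opair x y' \<^bold>\<in> ?F \<^bold>\<longrightarrow> y' \<^bold>= v)) s"
          using order_trans[OF s(1) r(1)] by blast
      qed
    qed
  next
    show "(\<^bold>\<forall>v. v \<^bold>\<in> name_of_set (k ` A) \<^bold>\<longrightarrow> (\<^bold>\<exists>x. opair x v \<^bold>\<in> ?F \<^bold>\<and>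
       (\<^bold>\<forall>x'. opair x' v \<^bold>\<in> ?F \<^bold>\<longrightarrow> x' \<^bold>= x))) p"
    proof (intro all_forcesI imp_forcesI regular_intros)
      fix v q assume "(v \<^bold>\<in> name_of_set (k ` A)) q"
      then have v: "dense_below q (\<lambda>q. \<exists>z\<in>k ` A. (v \<^bold>= z) q)"
        unfolding mem_name_of_set[OF image_k] .
      show "(\<^bold>\<exists>x. opair x v \<^bold>\<in> ?F \<^bold>\<and> (\<^bold>\<forall>x'. opair x' v \<^bold>\<in> ?F \<^bold>\<longrightarrow> x' \<^bold>= x)) q"
      proof (rule regular_dense, intro regular_intros, rule dense_belowI)
        fix q' assume "q' \<le> q"
        then obtain r \<alpha> where r: "r \<le> q'" "\<alpha> \<in> A" "(v \<^bold>= k \<alpha>) r"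
          using v unfolding dense_below_def by blast
        obtain s C where s: "s \<le> r" "B C \<alpha> s" using B_total r(2) by blast
        have vs: "(v \<^bold>= k \<alpha>) s" using r(3) s(1) forces_eq_mono by blast
        have "(opair (y C) v \<^bold>\<in> ?F) s"
          using forces_mem_cong_left[OF FI[OF r(2) s(2)]] opair_cong[OF forces_eq_refl vs] forces_eq_sym
          by blast
        moreover have "(\<^bold>\<forall>x'. opair x' v \<^bold>\<in> ?F \<^bold>\<longrightarrow> x' \<^bold>= y C) s"
        proof (intro all_forcesI imp_forcesI regular_intros)
          fix x' t assume t: "t \<le> s" "(opair x' v \<^bold>\<in> ?F) t"
          show "(x' \<^bold>= y C) t"
          proof (rule regular_by_dense[OF regular_eq FD2[OF t(2)]])
            fix u assume u: "u \<le> t" "\<exists>C \<alpha>. \<alpha> \<in> A \<and> B C \<alpha> u \<and> (x' \<^bold>= y C) u \<and> (v \<^bold>= k \<alpha>) u"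
            then obtain C' \<beta> where b: "\<beta> \<in> A" "B C' \<beta> u" "(x' \<^bold>= y C') u" "(v \<^bold>= k \<beta>) u" by blast
            have "u \<le> s" using t(1) u(1) order_trans by blast
            then have "(v \<^bold>= k \<alpha>) u" "B C \<alpha> u" using vs s(2) forces_eq_mono B_mono by blast+
            moreover from this have "(k \<alpha> \<^bold>= k \<beta>) u"
              using b(4) forces_eq_sym forces_eq_trans by blast
            then have "\<alpha> = \<beta>" using k_inj r(2) b(1) by blast
            ultimately have "(y C' \<^bold>= y C) u" using B_fun r(2) b(2) by blast
            then show "(x' \<^bold>= y C) u" using b(3) forces_eq_trans by blast
          qed
        qed
        ultimately have "(\<^bold>\<exists>x. opair x v \<^bold>\<in> ?F \<^bold>\<and> (\<^bold>\<forall>x'. opair x' v \<^bold>\<in> ?F \<^bold>\<longrightarrow> x' \<^bold>= x)) s"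
          by (intro exI_forces[where x = "y C"] regular_intros and_forcesI)
        then show "\<exists>s\<le>q'. (\<^bold>\<exists>x. opair x v \<^bold>\<in> ?F \<^bold>\<and> (\<^bold>\<forall>x'. opair x' v \<^bold>\<in> ?F \<^bold>\<longrightarrow> x' \<^bold>= x)) s"
          using order_trans[OF s(1) r(1)] by blast
      qed
    qed
  qed
qed

section \<open>Members and distinctness of ordinal check names\<close>

lemma mem_ord_check_at:
  assumes "Well_order r" "Field r \<lesssim> (UNIV :: 'i set)"
  shows "(x \<^bold>\<in> (ord_check_at r a :: ('p::order_top, 'i) name)) p \<longleftrightarrow>
    dense_below p (\<lambda>q. \<exists>b\<in>underS r a. (x \<^bold>= ord_check_at r b) q)"
proof -
  have "underS r a \<lesssim> (UNIV :: 'i set)"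
    using assms(2) underS_Field[of _ r a] subset_imp_lepoll[of "underS r a" "Field r"] lepoll_trans by blast
  then have "(ord_check_at r ` underS r a :: ('p, 'i) name set) \<lesssim> (UNIV :: 'i set)"
    using image_lepoll lepoll_trans by metis
  from mem_name_of_set[OF this]
  have "(x \<^bold>\<in> name_of_set (ord_check_at r ` underS r a)) p \<longleftrightarrow>
    dense_below p (\<lambda>q. \<exists>b\<in>underS r a. (x \<^bold>= ord_check_at r b) q)" by simp
  moreover have "ord_check_at r a = (name_of_set (ord_check_at r ` underS r a) :: ('p, 'i) name)"
    unfolding name_of_set_def by (subst ord_check_at_rec[OF assms(1)]) (rule arg_cong[of _ _ mk_name], auto)
  ultimately show ?thesis by simp
qed

text \<open>For \<open>a\<close> below \<open>b\<close>, forced equality would make the name of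
  \<open>a\<close> a member of itself, hence equal, under a stronger condition, to the name of some
  \<open>c\<close> below \<open>a\<close>. Induction on the larger index rules this out.\<close>

lemma ord_check_at_inj:
  assumes r: "Well_order r" "Field r \<lesssim> (UNIV :: 'i set)"
    and "a \<in> Field r" "b \<in> Field r"
    and "((ord_check_at r a :: ('p::order_top, 'i) name) \<^bold>= ord_check_at r b) p"
  shows "a = b"
proof -
  let ?c = "ord_check_at r :: _ \<Rightarrow> ('p, 'i) name"
  have wf: "wf (r - Id)" using r(1) by (simp add: well_order_on_def)
  have lt: "\<not> (?c a \<^bold>= ?c b) p" if "a \<in> underS r b" for a b p
    using that
  proof (induction b arbitrary: a p rule: wf_induct_rule[OF wf])
    case (1 b)
    show ?case
    proof
      assume eq: "(?c a \<^bold>= ?c b) p"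
      have "(?c a \<^bold>\<in> ?c b) p"
        unfolding mem_ord_check_at[OF r] using 1(2) forces_eq_refl by (intro dense_below_self) blast
      then have "(?c a \<^bold>\<in> ?c a) p"
        using eq forces_eq_sym forces_mem_cong_right by blast
      then obtain c q where "c \<in> underS r a" "(?c c \<^bold>= ?c a) q"
        unfolding mem_ord_check_at[OF r] dense_below_def using forces_eq_sym by blast
      moreover have "(a, b) \<in> r - Id" using 1(2) by (auto simp: underS_def)
      ultimately show False using 1(1) by blast
    qed
  qed
  have "Total r" using r(1) by (simp add: order_on_defs)
  then have "a = b \<or> a \<in> underS r b \<or> b \<in> underS r a"
    using assms(3,4) unfolding total_on_def underS_def by blast
  then show ?thesis using lt assms(5) forces_eq_sym by blast
qed

end

section \<open>Names for \<open>\<omega>\<close> and its subsets\<close>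

definition nat_name :: "nat \<Rightarrow> ('p::order_top, 'i) name" where
  "nat_name = ord_check_at natLeq"

definition omega_name :: "('p::order_top, 'i) name" where
  "omega_name = name_of_set (range nat_name)"

text \<open>A nice name for a set of natural numbers: the pair \<open>(n, t)\<close> puts
  \<open>n\<close> into the set as soon as \<open>t\<close> lies in the generic filter. The lemmas
  take \<open>R\<close> countable, which makes the name fit into the index type.\<close>

definition real_name :: "(nat \<times> 'p::order_top) set \<Rightarrow> ('p, 'i) name" where
  "real_name R = mk_name {(t, nat_name n) | n t. (n, t) \<in> R}"

lemma subset_iff_forces: "(a \<^bold>\<subseteq> b) p \<longleftrightarrow> (\<forall>x. \<forall>q\<le>p. (x \<^bold>\<in> a) q \<longrightarrow> (x \<^bold>\<in> b) q)"
  unfolding f_subset_def all_iff imp_iff[OF regular_mem regular_mem] ..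

lemma regular_subset: "regular (a \<^bold>\<subseteq> b)"
  unfolding f_subset_def by (intro regular_intros)

lemma is_succ_iff:
  "is_succ s a p \<longleftrightarrow> (\<forall>x. \<forall>q\<le>p. (x \<^bold>\<in> s) q \<longleftrightarrow> dense_below q (\<lambda>r. (x \<^bold>\<in> a) r \<or> (x \<^bold>= a) r))"
  unfolding is_succ_def all_iff iff_iff[OF regular_mem regular_or[OF regular_mem regular_eq]] or_iff ..

lemma regular_is_succ: "regular (is_succ s a)"
  unfolding is_succ_def by (intro regular_intros)

lemma regular_is_empty: "regular (is_empty a)"
  unfolding is_empty_def by (intro regular_intros)

lemma regular_is_inductive: "regular (is_inductive a)"
  unfolding is_inductive_def by (intro regular_intros regular_is_succ regular_is_empty)

lemma is_succ_cong:
  assumes "is_succ s a p" "(a \<^bold>= b) p"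
  shows "is_succ s b p"
  unfolding is_succ_iff
proof (intro allI impI)
  fix x q assume q: "q \<le> p"
  have eq: "(x \<^bold>\<in> a) r \<or> (x \<^bold>= a) r \<longleftrightarrow> (x \<^bold>\<in> b) r \<or> (x \<^bold>= b) r" if "r \<le> q" for r
    using forces_eq_mono[OF assms(2) order_trans[OF that q]]
    by (meson forces_eq_sym forces_eq_trans forces_mem_cong_right)
  have "(x \<^bold>\<in> s) q \<longleftrightarrow> dense_below q (\<lambda>r. (x \<^bold>\<in> a) r \<or> (x \<^bold>= a) r)"
    using assms(1) q unfolding is_succ_iff by blast
  also have "\<dots> \<longleftrightarrow> dense_below q (\<lambda>r. (x \<^bold>\<in> b) r \<or> (x \<^bold>= b) r)"
    unfolding dense_below_def using eq order_trans by meson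
  finally show "(x \<^bold>\<in> s) q \<longleftrightarrow> dense_below q (\<lambda>r. (x \<^bold>\<in> b) r \<or> (x \<^bold>= b) r)" .
qed

lemma is_succ_unique:
  assumes "is_succ s a p" "is_succ s' a p"
  shows "(s \<^bold>= s') p"
  using assms unfolding is_succ_iff by (intro forces_eq_ext) blast

context
  assumes continuum_le: "(UNIV :: nat set set) \<lesssim> (UNIV :: 'i set)"
begin

section \<open>Numerals and \<omega> in the extension\<close>

lemma nat_name_inj:
  assumes "((nat_name m :: ('p::order_top, 'i) name) \<^bold>= nat_name n) p"
  shows "m = n"
  using assms unfolding nat_name_def
  by (rule ord_check_at_inj[OF continuum_le natLeq_Well_order, rotated 3])
    (auto simp: Field_natLeq intro: countable_lepoll[OF continuum_le])

lemma mem_nat_name: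
  "(x \<^bold>\<in> (nat_name n :: ('p::order_top, 'i) name)) p \<longleftrightarrow>
    dense_below p (\<lambda>q. \<exists>m<n. (x \<^bold>= nat_name m) q)"
proof -
  have "underS natLeq n = {..<n}" by (auto simp: underS_def natLeq_def)
  moreover have "Field natLeq \<lesssim> (UNIV :: 'i set)"
    by (rule countable_lepoll[OF continuum_le]) simp
  ultimately show ?thesis
    unfolding nat_name_def
    using mem_ord_check_at[OF continuum_le natLeq_Well_order, of x n p] by (simp add: Bex_def)
qed

lemma range_nat_name_lepoll: "range (nat_name :: _ \<Rightarrow> ('p::order_top, 'i) name) \<lesssim> (UNIV :: 'i set)"
  by (rule countable_lepoll[OF continuum_le]) simp

lemma mem_omega_name:
  "(x \<^bold>\<in> (omega_name :: ('p::order_top, 'i) name)) p \<longleftrightarrow>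
    dense_below p (\<lambda>q. \<exists>n. (x \<^bold>= nat_name n) q)"
  unfolding omega_name_def mem_name_of_set[OF range_nat_name_lepoll] by simp

lemma nat_name_in_omega: "(nat_name n \<^bold>\<in> (omega_name :: ('p::order_top, 'i) name)) p"
  unfolding omega_name_def by (rule mem_name_of_setI[OF range_nat_name_lepoll]) simp

lemma is_empty_nat_name: "is_empty (nat_name 0 :: ('p::order_top, 'i) name) p"
  unfolding is_empty_def all_iff not_iff mem_nat_name dense_below_def by auto

lemma is_succ_nat_name: "is_succ (nat_name (Suc n)) (nat_name n :: ('p::order_top, 'i) name) p"
  unfolding is_succ_iff
proof (intro allI impI iffI)
  fix x :: "('p, 'i) name" and q assume "(x \<^bold>\<in> nat_name (Suc n)) q"
  then show "dense_below q (\<lambda>r. (x \<^bold>\<in> nat_name n) r \<or> (x \<^bold>= nat_name n) r)"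
    unfolding mem_nat_name[of _ "Suc n"]
  proof (rule dense_below_weaken)
    fix q assume "\<exists>m<Suc n. (x \<^bold>= nat_name m) q"
    then obtain m where m: "m < n \<or> m = n" "(x \<^bold>= nat_name m) q" by (auto simp: less_Suc_eq)
    then have "(x \<^bold>\<in> nat_name n) r \<or> (x \<^bold>= nat_name n) r" if "r \<le> q" for r
    proof (cases "m = n")
      case False
      then have "(nat_name m \<^bold>\<in> (nat_name n :: ('p, 'i) name)) r"
        unfolding mem_nat_name using m(1) forces_eq_refl by (intro dense_below_self) blast
      moreover have "(nat_name m \<^bold>= x) r"
        using forces_eq_mono[OF m(2) that] forces_eq_sym by blast
      ultimately show ?thesis using forces_mem_cong_left by blast
    qed (use forces_eq_mono[OF m(2) that] in simp)
    then show "dense_below q (\<lambda>r. (x \<^bold>\<in> nat_name n) r \<or> (x \<^bold>= nat_name n) r)"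
      by (rule dense_below_self)
  qed
next
  fix x :: "('p, 'i) name" and q
  assume "dense_below q (\<lambda>r. (x \<^bold>\<in> nat_name n) r \<or> (x \<^bold>= nat_name n) r)"
  then show "(x \<^bold>\<in> nat_name (Suc n)) q"
  proof (rule regular_by_dense[OF regular_mem])
    fix r assume "(x \<^bold>\<in> nat_name n) r \<or> (x \<^bold>= nat_name n) r"
    then show "(x \<^bold>\<in> nat_name (Suc n)) r"
    proof
      assume "(x \<^bold>\<in> nat_name n) r"
      then show ?thesis
        unfolding mem_nat_name
        by (rule dense_below_weaken) (intro dense_below_self, meson forces_eq_mono less_SucI)
    next
      assume "(x \<^bold>= nat_name n) r"
      then show ?thesis
        unfolding mem_nat_name by (intro dense_below_self) (use forces_eq_mono in blast)
    qed
  qed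
qed

lemma is_inductive_omega: "is_inductive (omega_name :: ('p::order_top, 'i) name) p"
  unfolding is_inductive_def
proof (intro and_forcesI all_forcesI imp_forcesI regular_intros regular_is_succ)
  show "(\<^bold>\<exists>e. is_empty e \<^bold>\<and> e \<^bold>\<in> (omega_name :: ('p, 'i) name)) p"
    by (intro exI_forces[where x = "nat_name 0"] and_forcesI is_empty_nat_name nat_name_in_omega
        regular_intros regular_is_empty)
next
  fix x :: "('p, 'i) name" and q assume "(x \<^bold>\<in> omega_name) q"
  then show "(\<^bold>\<exists>s. is_succ s x \<^bold>\<and> s \<^bold>\<in> omega_name) q"
    unfolding mem_omega_name[of x]
  proof (rule regular_by_dense[rotated])
    fix r assume "\<exists>n. (x \<^bold>= nat_name n) r"
    then obtain n where "(nat_name n \<^bold>= x) r" using forces_eq_sym by blast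
    then show "(\<^bold>\<exists>s. is_succ s x \<^bold>\<and> s \<^bold>\<in> omega_name) r"
      by (intro exI_forces[where x = "nat_name (Suc n)"] and_forcesI nat_name_in_omega
          is_succ_cong[OF is_succ_nat_name] regular_intros regular_is_succ)
  qed (intro regular_intros regular_is_succ)
qed

text \<open>Induction in the ground model: the empty set and successors are unique up to forced
  equality, so the witnesses that \<open>v\<close> supplies may be replaced by numeral
  names.\<close>

lemma nat_name_in_inductive:
  assumes "is_inductive (v :: ('p::order_top, 'i) name) p"
  shows "(nat_name n \<^bold>\<in> v) p"
proof (induction n)
  case 0
  have ex: "(\<^bold>\<exists>e. is_empty e \<^bold>\<and> e \<^bold>\<in> v) p"
    using assms unfolding is_inductive_def and_iff by blast
  show ?case
  proof (rule regular_by_dense[OF regular_mem ex[unfolded ex_iff]])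
    fix q assume "\<exists>e. (is_empty e \<^bold>\<and> e \<^bold>\<in> v) q"
    then obtain e where e: "is_empty e q" "(e \<^bold>\<in> v) q" unfolding and_iff by blast
    have "(e \<^bold>= nat_name 0) q"
      using e(1) is_empty_nat_name[of q] unfolding is_empty_def all_iff not_iff
      by (intro forces_eq_ext) blast
    then show "(nat_name 0 \<^bold>\<in> v) q" using e(2) forces_mem_cong_left by blast
  qed
next
  case (Suc n)
  have "(\<^bold>\<forall>x. x \<^bold>\<in> v \<^bold>\<longrightarrow> (\<^bold>\<exists>s. is_succ s x \<^bold>\<and> s \<^bold>\<in> v)) p"
    using assms unfolding is_inductive_def and_iff by blast
  then have "(nat_name n \<^bold>\<in> v \<^bold>\<longrightarrow> (\<^bold>\<exists>s. is_succ s (nat_name n) \<^bold>\<and> s \<^bold>\<in> v)) p"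
    unfolding all_iff by blast
  moreover have "regular (\<^bold>\<exists>s. is_succ s (nat_name n) \<^bold>\<and> s \<^bold>\<in> v)"
    by (intro regular_intros regular_is_succ)
  ultimately have ex: "(\<^bold>\<exists>s. is_succ s (nat_name n) \<^bold>\<and> s \<^bold>\<in> v) p"
    using Suc imp_iff[OF regular_mem] order_refl by blast
  show ?case
  proof (rule regular_by_dense[OF regular_mem ex[unfolded ex_iff]])
    fix q assume "\<exists>s. (is_succ s (nat_name n) \<^bold>\<and> s \<^bold>\<in> v) q"
    then obtain s where "is_succ s (nat_name n) q" "(s \<^bold>\<in> v) q" unfolding and_iff by blast
    then show "(nat_name (Suc n) \<^bold>\<in> v) q"
      using is_succ_unique[OF _ is_succ_nat_name] forces_mem_cong_left by blast
  qed
qed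

lemma is_omega_omega_name: "is_omega (omega_name :: ('p::order_top, 'i) name) p"
  unfolding is_omega_def
proof (intro and_forcesI all_forcesI imp_forcesI is_inductive_omega regular_is_inductive regular_subset)
  fix v :: "('p, 'i) name" and q assume v: "is_inductive v q"
  show "(omega_name \<^bold>\<subseteq> v) q"
    unfolding subset_iff_forces
  proof (intro allI impI)
    fix x :: "('p, 'i) name" and r assume r: "r \<le> q" "(x \<^bold>\<in> omega_name) r"
    show "(x \<^bold>\<in> v) r"
    proof (rule regular_by_dense[OF regular_mem r(2)[unfolded mem_omega_name]])
      fix s assume s: "s \<le> r" "\<exists>n. (x \<^bold>= nat_name n) s"
      then obtain n where "(nat_name n \<^bold>= x) s" using forces_eq_sym by blast
      moreover have "is_inductive v s"
        using regular_mono[OF regular_is_inductive v] s(1) r(1) order_trans by blast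
      ultimately show "(x \<^bold>\<in> v) s"
        using nat_name_in_inductive forces_mem_cong_left by blast
    qed
  qed
qed

text \<open>Members of \<omega> are densely equal to numeral names, so numerals suffice to compare
  two of its subsets.\<close>

lemma eq_of_subset_omega:
  fixes x x' :: "('p::order_top, 'i) name"
  assumes "(x \<^bold>\<subseteq> omega_name) p" "(x' \<^bold>\<subseteq> omega_name) p"
    and "\<And>n q. q \<le> p \<Longrightarrow> (nat_name n \<^bold>\<in> x) q \<longleftrightarrow> (nat_name n \<^bold>\<in> x') q"
  shows "(x \<^bold>= x') p"
proof -
  have sub: "(z \<^bold>\<in> b) q"
    if "(a \<^bold>\<subseteq> omega_name) p" "\<And>n q. q \<le> p \<Longrightarrow> (nat_name n \<^bold>\<in> a) q \<Longrightarrow> (nat_name n \<^bold>\<in> b) q"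
      and q: "q \<le> p" and z: "(z \<^bold>\<in> a) q" for a b z :: "('p, 'i) name" and q
  proof -
    have "(z \<^bold>\<in> omega_name) q" using that unfolding subset_iff_forces by blast
    then show ?thesis
      unfolding mem_omega_name
    proof (rule regular_by_dense[OF regular_mem])
      fix r assume r: "r \<le> q" "\<exists>n. (z \<^bold>= nat_name n) r"
      then obtain n where n: "(z \<^bold>= nat_name n) r" by blast
      have "(nat_name n \<^bold>\<in> a) r" using forces_mem_cong_left[OF forces_mem_mono[OF z r(1)] n] .
      then have "(nat_name n \<^bold>\<in> b) r" using that(2) order_trans[OF r(1) q] by blast
      then show "(z \<^bold>\<in> b) r" using n forces_eq_sym forces_mem_cong_left by blast
    qed
  qed
  show ?thesis
    by (rule forces_eq_ext) (use sub[OF assms(1)] sub[OF assms(2)] assms(3) in blast)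
qed

section \<open>Nice names and the power set of \<omega>\<close>

lemma elems_real_name:
  assumes "countable R"
  shows "elems (real_name R :: ('p::order_top, 'i) name) = {(t, nat_name n) | n t. (n, t) \<in> R}"
proof -
  have "{(t, nat_name n :: ('p, 'i) name) | n t. (n, t) \<in> R} = (\<lambda>(n, t). (t, nat_name n)) ` R"
    by auto
  then have "countable {(t, nat_name n :: ('p, 'i) name) | n t. (n, t) \<in> R}"
    using assms by simp
  then show ?thesis
    unfolding real_name_def by (intro elems_mk_name countable_lepoll[OF continuum_le])
qed

lemma nat_name_in_real_name:
  assumes "countable R"
  shows "(nat_name n \<^bold>\<in> (real_name R :: ('p::order_top, 'i) name)) p \<longleftrightarrow>
    dense_below p (\<lambda>q. \<exists>t. (n, t) \<in> R \<and> q \<le> t)"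
proof -
  have "(\<exists>t y. (\<exists>m t'. t = t' \<and> y = nat_name m \<and> (m, t') \<in> R) \<and> q \<le> t \<and>
      ((nat_name n :: ('p, 'i) name) \<^bold>= y) q) \<longleftrightarrow> (\<exists>t. (n, t) \<in> R \<and> q \<le> t)" for q
    using nat_name_inj forces_eq_refl by blast
  then show ?thesis
    unfolding forces_mem_def elems_real_name[OF assms] by simp
qed

lemma real_name_subset_omega:
  assumes "countable R"
  shows "((real_name R :: ('p::order_top, 'i) name) \<^bold>\<subseteq> omega_name) p"
  unfolding subset_iff_forces
proof (intro allI impI)
  fix x :: "('p, 'i) name" and q assume "(x \<^bold>\<in> real_name R) q"
  then show "(x \<^bold>\<in> omega_name) q"
    unfolding forces_mem_def[of x "real_name R"] elems_real_name[OF assms] mem_omega_name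
    by (rule dense_below_weaken) (intro dense_below_self, use forces_eq_mono in blast)
qed

text \<open>Finding a code below some stronger condition is enough, because membership in
  \<open>name_of_set\<close> is itself a density statement.\<close>

lemma is_powersetI:
  fixes y :: "'c \<Rightarrow> ('p::order_top, 'i) name"
  assumes "range y \<lesssim> (UNIV :: 'i set)"
    and sub: "\<And>C p. (y C \<^bold>\<subseteq> w) p"
    and ex: "\<And>x p. (x \<^bold>\<subseteq> w) p \<Longrightarrow> \<exists>q\<le>p. \<exists>C. (x \<^bold>= y C) q"
  shows "is_powerset (name_of_set (range y)) w p"
  unfolding is_powerset_def all_iff iff_iff[OF regular_mem regular_subset] mem_name_of_set[OF assms(1)]
proof (intro allI impI iffI)
  fix x q assume "dense_below q (\<lambda>q. \<exists>z\<in>range y. (x \<^bold>= z) q)"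
  then show "(x \<^bold>\<subseteq> w) q"
  proof (rule regular_by_dense[OF regular_subset])
    fix r assume "\<exists>z\<in>range y. (x \<^bold>= z) r"
    then obtain C where "(x \<^bold>= y C) r" by blast
    then show "(x \<^bold>\<subseteq> w) r"
      using sub[of C r] forces_eq_mono forces_mem_cong_right unfolding subset_iff_forces by blast
  qed
next
  fix x q assume "(x \<^bold>\<subseteq> w) q"
  then show "dense_below q (\<lambda>q. \<exists>z\<in>range y. (x \<^bold>= z) q)"
    using ex regular_mono[OF regular_subset] by (intro dense_belowI) blast
qed

end

section \<open>A forced Cantor--Bernstein theorem\<close>

text \<open>
  The data describe, in the extension, a partial map from \<open>A\<close> onto a set of codes (\<open>H \<alpha> C p\<close>: \<open>p\<close>
  forces that \<open>\<alpha>\<close> is mapped to the element coded by \<open>C\<close>) and an injection \<open>g\<close> of \<open>A\<close> into the codes.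
  Picking least preimages turns the former into an injection of the codes into \<open>A\<close>.  The
  bijection is the one from the Cantor--Bernstein proof: \<open>D \<alpha> p\<close> says that \<open>p\<close> forces the backward
  orbit of \<open>\<alpha>\<close> to leave the range of that injection; on such \<open>\<alpha>\<close> use \<open>g\<close>, on the others \<open>H\<close>.
\<close>

locale forced_cantor_bernstein =
  fixes A :: "'k set" and less :: "'k rel"
    and E :: "'c \<Rightarrow> 'c \<Rightarrow> 'p::preorder \<Rightarrow> bool"
    and H :: "'k \<Rightarrow> 'c \<Rightarrow> 'p \<Rightarrow> bool"
    and g :: "'k \<Rightarrow> 'c"
  assumes wf_less: "wf less"
    and total_less: "\<alpha> \<in> A \<Longrightarrow> \<beta> \<in> A \<Longrightarrow> \<alpha> \<noteq> \<beta> \<Longrightarrow> (\<alpha>, \<beta>) \<in> less \<or> (\<beta>, \<alpha>) \<in> less"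
    and E_sym: "E C C' p \<Longrightarrow> E C' C p"
    and E_trans: "E C C' p \<Longrightarrow> E C' C'' p \<Longrightarrow> E C C'' p"
    and E_mono: "E C C' p \<Longrightarrow> q \<le> p \<Longrightarrow> E C C' q"
    and H_mono: "H \<alpha> C p \<Longrightarrow> q \<le> p \<Longrightarrow> H \<alpha> C q"
    and H_cong: "H \<alpha> C p \<Longrightarrow> E C C' p \<Longrightarrow> H \<alpha> C' p"
    and H_fun: "H \<alpha> C p \<Longrightarrow> H \<alpha> C' p \<Longrightarrow> E C C' p"
    and H_surj: "\<exists>\<alpha>\<in>A. \<exists>q\<le>p. H \<alpha> C q"
    and E_refl: "E C C p"
    and g_inj: "\<alpha> \<in> A \<Longrightarrow> \<beta> \<in> A \<Longrightarrow> E (g \<alpha>) (g \<beta>) p \<Longrightarrow> \<alpha> = \<beta>"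
begin

text \<open>The first two rules are the two ways of lying outside the range of the least-preimage
  injection: having no value, or sharing it with an earlier index. The third steps back along the
  orbit. An orbit that leaves the range does so after finitely many steps, hence an inductive
  definition.\<close>

inductive D :: "'k \<Rightarrow> 'p \<Rightarrow> bool" where
  undefined_value: "(\<And>q C. q \<le> p \<Longrightarrow> \<not> H \<alpha> C q) \<Longrightarrow> D \<alpha> p"
| not_first: "\<beta> \<in> A \<Longrightarrow> (\<beta>, \<alpha>) \<in> less \<Longrightarrow> H \<alpha> C p \<Longrightarrow> H \<beta> C p \<Longrightarrow> D \<alpha> p"
| predecessor: "\<beta> \<in> A \<Longrightarrow> H \<alpha> (g \<beta>) p \<Longrightarrow> D \<beta> p \<Longrightarrow> D \<alpha> p"

definition N :: "'k \<Rightarrow> 'p \<Rightarrow> bool" where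
  "N \<alpha> p \<longleftrightarrow> (\<forall>q\<le>p. \<not> D \<alpha> q)"

definition B :: "'c \<Rightarrow> 'k \<Rightarrow> 'p \<Rightarrow> bool" where
  "B C \<alpha> p \<longleftrightarrow> D \<alpha> p \<and> E C (g \<alpha>) p \<or> N \<alpha> p \<and> H \<alpha> C p"

lemma D_mono: "D \<alpha> p \<Longrightarrow> q \<le> p \<Longrightarrow> D \<alpha> q"
proof (induction rule: D.induct)
  case (undefined_value p \<alpha>)
  then show ?case by (meson D.undefined_value order_trans)
next
  case (not_first \<beta> \<alpha> C p)
  then show ?case by (meson D.not_first H_mono)
next
  case (predecessor \<beta> \<alpha> p)
  then show ?case by (meson D.predecessor H_mono)
qed

lemma N_not_D: "N \<alpha> p \<Longrightarrow> \<not> D \<alpha> p"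
  by (simp add: N_def)

lemma N_mono: "N \<alpha> p \<Longrightarrow> q \<le> p \<Longrightarrow> N \<alpha> q"
  unfolding N_def by (meson order_trans)

lemma B_mono: "B C \<alpha> p \<Longrightarrow> q \<le> p \<Longrightarrow> B C \<alpha> q"
  unfolding B_def by (meson D_mono E_mono H_mono N_mono)

lemma B_cong: "B C \<alpha> p \<Longrightarrow> E C C' p \<Longrightarrow> B C' \<alpha> p"
  unfolding B_def by (meson E_sym E_trans H_cong)

lemma B_total: "\<exists>q\<le>p. \<exists>C. B C \<alpha> q"
proof (cases "\<exists>q\<le>p. D \<alpha> q")
  case True
  then show ?thesis unfolding B_def using E_refl by blast
next
  case False
  then have N: "N \<alpha> p" unfolding N_def by blast
  then obtain q C where "q \<le> p" "H \<alpha> C q"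
    using D.undefined_value N_not_D by blast
  then show ?thesis unfolding B_def using N N_mono by blast
qed

lemma B_fun: "B C \<alpha> p \<Longrightarrow> B C' \<alpha> p \<Longrightarrow> E C C' p"
  unfolding B_def by (meson E_sym E_trans H_fun N_not_D)

lemma B_inj:
  assumes "\<alpha> \<in> A" "\<beta> \<in> A" "B C \<alpha> p" "B C \<beta> p"
  shows "\<alpha> = \<beta>"
proof -
  \<comment> \<open>Mixed case: the value of \<open>\<delta>\<close> is \<open>g \<gamma>\<close>
    with \<open>\<gamma>\<close> in \<open>D\<close>, so the rule \<open>predecessor\<close> would
    put \<open>\<delta>\<close> into \<open>D\<close> too.\<close>
  have DN: False if "\<gamma> \<in> A" "D \<gamma> p" "E C (g \<gamma>) p" "N \<delta> p" "H \<delta> C p" for \<gamma> \<delta>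
    using D.predecessor[OF that(1) H_cong[OF that(5,3)] that(2)] N_not_D that(4) by blast
  \<comment> \<open>Two indices in \<open>N\<close> with a common value: the later one would be in
    \<open>D\<close> for not being first.\<close>
  have NN: "(\<gamma>, \<delta>) \<notin> less" if "\<gamma> \<in> A" "N \<delta> p" "H \<gamma> C p" "H \<delta> C p" for \<gamma> \<delta>
    using D.not_first[OF that(1) _ that(4,3)] N_not_D that(2) by blast
  consider "D \<alpha> p" "E C (g \<alpha>) p" "D \<beta> p" "E C (g \<beta>) p" | "N \<alpha> p" "H \<alpha> C p" "N \<beta> p" "H \<beta> C p"
    using assms DN unfolding B_def by blast
  then show ?thesis
  proof cases
    case 1
    then show ?thesis using g_inj[OF assms(1,2)] E_sym E_trans by blast
  next
    case 2
    then show ?thesis using NN total_less assms by blast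
  qed
qed

lemma B_surj: "\<exists>q\<le>p. \<exists>\<alpha>\<in>A. B C \<alpha> q"
proof -
  \<comment> \<open>Minimality is taken over all extensions of \<open>p\<close> at once, so below
    \<open>p\<close> no earlier index is ever sent to \<open>C\<close> and the rule
    \<open>not_first\<close> cannot apply.\<close>
  let ?M = "{\<alpha> \<in> A. \<exists>q\<le>p. H \<alpha> C q}"
  obtain \<alpha> where \<alpha>: "\<alpha> \<in> ?M" and min: "\<And>\<beta>. (\<beta>, \<alpha>) \<in> less \<Longrightarrow> \<beta> \<notin> ?M"
    using wfE_min[OF wf_less, of _ ?M] H_surj[of p C] by blast
  then obtain r where r: "r \<le> p" "H \<alpha> C r" and A: "\<alpha> \<in> A" by blast
  show ?thesis
  proof (cases "\<exists>q\<le>r. D \<alpha> q")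
    case True
    then obtain q where q: "q \<le> r" "D \<alpha> q" by blast
    have Hq: "H \<alpha> C q" and qp: "q \<le> p" using r q H_mono order_trans by blast+
    from q(2) show ?thesis
    proof cases
      case undefined_value
      then show ?thesis using Hq order_refl by blast
    next
      case (not_first \<beta> C')
      then have "H \<beta> C q" using Hq H_fun H_cong by blast
      then show ?thesis using min not_first qp by blast
    next
      case (predecessor \<beta>)
      \<comment> \<open>\<open>C\<close> is forced equal to \<open>g \<beta>\<close> with
        \<open>\<beta>\<close> in \<open>D\<close>, so the preimage of \<open>C\<close> is
        \<open>\<beta>\<close> and not \<open>\<alpha>\<close>.\<close>
      then have "B C \<beta> q" unfolding B_def using H_fun Hq by blast
      then show ?thesis using qp predecessor by blast
    qed
  next
    case False
    then have "N \<alpha> r" unfolding N_def by blast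
    then show ?thesis unfolding B_def using r A by blast
  qed
qed

end

section \<open>Laver trees\<close>

definition comparable :: "nat list \<Rightarrow> nat list \<Rightarrow> bool" where
  "comparable s t \<longleftrightarrow> prefix s t \<or> prefix t s"

text \<open>A Laver tree with its root made a parameter, since pure extensions are those that keep
  the root.\<close>

definition laver_with_stem :: "nat list \<Rightarrow> nat list set \<Rightarrow> bool" where
  "laver_with_stem \<sigma> T \<longleftrightarrow> (\<forall>t\<in>T. \<forall>s. prefix s t \<longrightarrow> s \<in> T) \<and> \<sigma> \<in> T \<and>
     (\<forall>t\<in>T. comparable \<sigma> t) \<and> (\<forall>t\<in>T. prefix \<sigma> t \<longrightarrow> infinite {n. t @ [n] \<in> T})"

definition restrict_tree :: "nat list set \<Rightarrow> nat list \<Rightarrow> nat list set" where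
  "restrict_tree T s = {t \<in> T. comparable s t}"

lemma laver_tree_iff: "laver_tree T \<longleftrightarrow> (\<exists>\<sigma>. laver_with_stem \<sigma> T)"
  unfolding laver_tree_def laver_with_stem_def comparable_def by blast

lemma laver_with_stem_closed: "laver_with_stem \<sigma> T \<Longrightarrow> t \<in> T \<Longrightarrow> prefix s t \<Longrightarrow> s \<in> T"
  unfolding laver_with_stem_def by blast

lemma laver_with_stem_comparable: "laver_with_stem \<sigma> T \<Longrightarrow> t \<in> T \<Longrightarrow> comparable \<sigma> t"
  unfolding laver_with_stem_def by blast

lemma laver_with_stem_in: "laver_with_stem \<sigma> T \<Longrightarrow> \<sigma> \<in> T"
  unfolding laver_with_stem_def by blast

lemma laver_with_stem_infinite:
  "laver_with_stem \<sigma> T \<Longrightarrow> t \<in> T \<Longrightarrow> prefix \<sigma> t \<Longrightarrow> infinite {n. t @ [n] \<in> T}"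
  unfolding laver_with_stem_def by blast

lemma comparable_refl: "comparable s s"
  by (simp add: comparable_def)

lemma comparable_prefix: "comparable s t \<Longrightarrow> prefix u t \<Longrightarrow> comparable s u"
  unfolding comparable_def by (meson prefix_order.trans prefix_same_cases)

lemma comparable_length: "comparable s t \<Longrightarrow> length s \<le> length t \<Longrightarrow> prefix s t"
  unfolding comparable_def by (metis prefix_length_le prefix_length_prefix prefix_order.refl)

lemma restrict_tree_laver:
  assumes "laver_with_stem \<sigma> T" "s \<in> T" "prefix \<sigma> s"
  shows "laver_with_stem s (restrict_tree T s)"
  unfolding laver_with_stem_def
proof (intro conjI ballI allI impI)
  fix t u assume "t \<in> restrict_tree T s" "prefix u t"
  then show "u \<in> restrict_tree T s"
    using comparable_prefix laver_with_stem_closed[OF assms(1)] unfolding restrict_tree_def by blast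
next
  fix t assume t: "t \<in> restrict_tree T s" "prefix s t"
  then have "{n. t @ [n] \<in> T} = {n. t @ [n] \<in> restrict_tree T s}"
    unfolding restrict_tree_def comparable_def by auto
  moreover have "infinite {n. t @ [n] \<in> T}"
    using laver_with_stem_infinite[OF assms(1)] t assms(3) prefix_order.trans
    unfolding restrict_tree_def by blast
  ultimately show "infinite {n. t @ [n] \<in> restrict_tree T s}" by simp
qed (use assms comparable_refl in \<open>auto simp: restrict_tree_def\<close>)

lemma restrict_tree_subset: "restrict_tree T s \<subseteq> T"
  by (auto simp: restrict_tree_def)

lemma laver_extend_stem:
  assumes "laver_with_stem \<sigma> T" "t \<in> T" "prefix \<sigma> t"
  shows "\<exists>u\<in>T. prefix t u \<and> length u = length t + k"
proof (induction k)
  case 0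
  then show ?case using assms(2) by force
next
  case (Suc k)
  then obtain u where u: "u \<in> T" "prefix t u" "length u = length t + k" by blast
  then have "infinite {n. u @ [n] \<in> T}"
    using laver_with_stem_infinite[OF assms(1)] assms(3) prefix_order.trans by blast
  then obtain n where "u @ [n] \<in> T" using not_finite_existsD by blast
  then show ?case using u by (intro bexI[of _ "u @ [n]"]) (auto intro: prefix_order.trans)
qed

lemma laver_long_node:
  assumes "laver_with_stem \<sigma> T"
  shows "\<exists>u\<in>T. prefix \<sigma> u \<and> k \<le> length u"
  using laver_extend_stem[OF assms laver_with_stem_in[OF assms], of k] by auto

lemma laver_UN:
  assumes "infinite M" and S: "\<And>n. n \<in> M \<Longrightarrow> laver_with_stem (\<sigma> @ [n]) (S n)"
  shows "laver_with_stem \<sigma> (\<Union>n\<in>M. S n)"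
  unfolding laver_with_stem_def
proof (intro conjI ballI allI impI)
  fix t s assume "t \<in> (\<Union>n\<in>M. S n)" "prefix s t"
  then show "s \<in> (\<Union>n\<in>M. S n)" using laver_with_stem_closed[OF S] by blast
next
  obtain n where "n \<in> M" using assms(1) infinite_imp_nonempty by blast
  moreover have "\<sigma> \<in> S n" if "n \<in> M" for n
    using laver_with_stem_closed[OF S laver_with_stem_in[OF S]] that by force
  ultimately show "\<sigma> \<in> (\<Union>n\<in>M. S n)" by blast
next
  fix t assume "t \<in> (\<Union>n\<in>M. S n)"
  then obtain n where "n \<in> M" "comparable (\<sigma> @ [n]) t" using laver_with_stem_comparable[OF S] by blast
  then show "comparable \<sigma> t"
    unfolding comparable_def by (meson prefixI prefix_order.trans prefix_same_cases)
next
  fix t assume t: "t \<in> (\<Union>n\<in>M. S n)" "prefix \<sigma> t"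
  show "infinite {n. t @ [n] \<in> (\<Union>n\<in>M. S n)}"
  proof (cases "t = \<sigma>")
    case True
    then have "M \<subseteq> {n. t @ [n] \<in> (\<Union>n\<in>M. S n)}" using laver_with_stem_in[OF S] by blast
    then show ?thesis using assms(1) finite_subset by blast
  next
    case False
    then have len: "length \<sigma> < length t"
      using t(2) by (metis le_neq_implies_less prefix_length_le prefix_length_prefix prefix_order.antisym
          prefix_order.refl order_refl)
    obtain n where n: "n \<in> M" "t \<in> S n" using t(1) by blast
    then have "prefix (\<sigma> @ [n]) t"
      using comparable_length[OF laver_with_stem_comparable[OF S]] len by simp
    then have "infinite {m. t @ [m] \<in> S n}"
      using laver_with_stem_infinite[OF S] n by blast
    moreover have "{m. t @ [m] \<in> S n} \<subseteq> {n. t @ [n] \<in> (\<Union>n\<in>M. S n)}" using n(1) by blast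
    ultimately show ?thesis using finite_subset by blast
  qed
qed

section \<open>Conditions, stems and restriction to a node\<close>

definition stem_of :: "nat list \<Rightarrow> laver \<Rightarrow> bool" where
  "stem_of \<sigma> p \<longleftrightarrow> laver_with_stem \<sigma> (Rep_laver p)"

lemma stem_of_ex: "\<exists>\<sigma>. stem_of \<sigma> p"
  using Rep_laver[of p] unfolding stem_of_def laver_tree_iff by simp

lemma laver_condition:
  assumes "laver_with_stem \<sigma> T"
  obtains p where "Rep_laver p = T" "stem_of \<sigma> p"
proof -
  have "Rep_laver (Abs_laver T) = T"
    using assms by (intro Abs_laver_inverse) (auto simp: laver_tree_iff)
  then show thesis using that assms unfolding stem_of_def by metis
qed

definition restrict :: "laver \<Rightarrow> nat list \<Rightarrow> laver" where
  "restrict p s = Abs_laver (restrict_tree (Rep_laver p) s)"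

lemma restrict:
  assumes "stem_of \<sigma> p" "s \<in> Rep_laver p" "prefix \<sigma> s"
  shows "Rep_laver (restrict p s) = restrict_tree (Rep_laver p) s"
    and "stem_of s (restrict p s)"
proof -
  have "laver_with_stem s (restrict_tree (Rep_laver p) s)"
    using restrict_tree_laver assms unfolding stem_of_def by blast
  then show "Rep_laver (restrict p s) = restrict_tree (Rep_laver p) s"
    unfolding restrict_def by (intro Abs_laver_inverse) (auto simp: laver_tree_iff)
  with \<open>laver_with_stem s _\<close> show "stem_of s (restrict p s)"
    unfolding stem_of_def by simp
qed

lemma restrict_le:
  assumes "stem_of \<sigma> p" "s \<in> Rep_laver p" "prefix \<sigma> s"
  shows "restrict p s \<le> p"
  unfolding less_eq_laver_def restrict(1)[OF assms] by (rule restrict_tree_subset)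

text \<open>Otherwise \<open>\<tau>\<close> is a proper initial segment of \<open>\<sigma>\<close>.
  All nodes of \<open>p\<close> are comparable with \<open>\<sigma>\<close>, so
  \<open>\<tau>\<close> would have at most one successor in \<open>q\<close>.\<close>

lemma stem_mono:
  assumes "stem_of \<sigma> p" "stem_of \<tau> q" "q \<le> p"
  shows "prefix \<sigma> \<tau>"
proof (rule ccontr)
  assume np: "\<not> prefix \<sigma> \<tau>"
  have sub: "Rep_laver q \<subseteq> Rep_laver p" using assms(3) by (simp add: less_eq_laver_def)
  have "comparable \<sigma> \<tau>"
    using assms sub laver_with_stem_comparable laver_with_stem_in unfolding stem_of_def by blast
  then obtain m v where \<sigma>: "\<sigma> = \<tau> @ m # v"
    using np unfolding comparable_def prefix_def by (metis append_Nil2 neq_Nil_conv)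
  have "n = m" if "\<tau> @ [n] \<in> Rep_laver q" for n
  proof -
    have "comparable \<sigma> (\<tau> @ [n])"
      using that sub assms(1) laver_with_stem_comparable unfolding stem_of_def by blast
    then show ?thesis by (auto simp: comparable_def \<sigma> prefix_def append_eq_append_conv2 append_eq_Cons_conv Cons_eq_append_conv)
  qed
  then have "{n. \<tau> @ [n] \<in> Rep_laver q} \<subseteq> {m}" by blast
  then have "finite {n. \<tau> @ [n] \<in> Rep_laver q}" using finite_subset by blast
  then show False
    using assms(2) laver_with_stem_infinite laver_with_stem_in unfolding stem_of_def by blast
qed

lemma le_restrict:
  assumes p: "stem_of \<sigma> p" "s \<in> Rep_laver p" "prefix \<sigma> s"
    and q: "q \<le> p" "\<And>t. t \<in> Rep_laver q \<Longrightarrow> comparable s t"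
  shows "q \<le> restrict p s"
  using q unfolding less_eq_laver_def restrict(1)[OF p] restrict_tree_def by blast

section \<open>Pure decision and fusion\<close>

definition decides :: "laver \<Rightarrow> laver sentence \<Rightarrow> bool" where
  "decides p \<phi> \<longleftrightarrow> \<phi> p \<or> (\<^bold>\<not> \<phi>) p"

lemma decides_mono: "regular \<phi> \<Longrightarrow> decides p \<phi> \<Longrightarrow> q \<le> p \<Longrightarrow> decides q \<phi>"
  unfolding decides_def using regular_mono regular_not by metis

lemma dense_decides: "\<exists>q\<le>p. decides q \<phi>"
  unfolding decides_def not_iff by blast

text \<open>Every extension of the amalgam has a node longer than \<open>\<sigma>\<close>; its entry
  right after \<open>\<sigma>\<close> singles out one \<open>S n\<close>, and restricting to that
  node lands inside it. Hence a regular sentence forced by all \<open>S n\<close> is forced by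
  \<open>U\<close>.\<close>

lemma dense_below_union:
  assumes "stem_of \<sigma> U" and M: "Rep_laver U = (\<Union>n\<in>M. Rep_laver (S n))"
    and S: "\<And>n. n \<in> M \<Longrightarrow> stem_of (\<sigma> @ [n]) (S n)"
  shows "dense_below U (\<lambda>r. \<exists>n\<in>M. r \<le> S n)"
proof (rule dense_belowI)
  fix q assume q: "q \<le> U"
  obtain \<tau> where \<tau>: "stem_of \<tau> q" using stem_of_ex by blast
  then obtain t where t: "t \<in> Rep_laver q" "prefix \<tau> t" "Suc (length \<sigma>) \<le> length t"
    using laver_long_node unfolding stem_of_def by blast
  then obtain n where n: "n \<in> M" "t \<in> Rep_laver (S n)"
    using q M unfolding less_eq_laver_def by blast
  have cmp: "comparable (\<sigma> @ [m]) u" if "m \<in> M" "u \<in> Rep_laver (S m)" for m u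
    using laver_with_stem_comparable S that unfolding stem_of_def by blast
  have pt: "prefix (\<sigma> @ [n]) t"
    using comparable_length[OF cmp[OF n]] t(3) by simp
  have "Rep_laver (restrict q t) \<subseteq> Rep_laver (S n)"
  proof
    fix u assume "u \<in> Rep_laver (restrict q t)"
    then have u: "u \<in> Rep_laver q" "comparable t u"
      unfolding restrict(1)[OF \<tau> t(1,2)] restrict_tree_def by blast+
    show "u \<in> Rep_laver (S n)"
    proof (cases "prefix u t")
      case True
      then show ?thesis using n S laver_with_stem_closed unfolding stem_of_def by blast
    next
      case False
      then have tu: "prefix t u" using u(2) unfolding comparable_def by blast
      obtain m where m: "m \<in> M" "u \<in> Rep_laver (S m)"
        using u(1) q M unfolding less_eq_laver_def by blast
      have "length (\<sigma> @ [m]) \<le> length u" using t(3) prefix_length_le[OF tu] by simp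
      then have "prefix (\<sigma> @ [m]) u" using comparable_length[OF cmp[OF m]] by simp
      moreover have "prefix (\<sigma> @ [n]) u" using pt tu prefix_order.trans by blast
      ultimately have "m = n" by (auto simp: prefix_def)
      then show ?thesis using m by simp
    qed
  qed
  then show "\<exists>r\<le>q. \<exists>n\<in>M. r \<le> S n"
    using restrict_le[OF \<tau> t(1,2)] n(1) unfolding less_eq_laver_def by blast
qed

lemma laver_union:
  assumes "infinite M" and S: "\<And>n. n \<in> M \<Longrightarrow> stem_of (\<sigma> @ [n]) (S n)"
  obtains U where "stem_of \<sigma> U" "Rep_laver U = (\<Union>n\<in>M. Rep_laver (S n))"
    "dense_below U (\<lambda>r. \<exists>n\<in>M. r \<le> S n)"
proof -
  have "laver_with_stem \<sigma> (\<Union>n\<in>M. Rep_laver (S n))"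
    by (rule laver_UN[OF assms(1)]) (use S in \<open>simp add: stem_of_def\<close>)
  then obtain U where "Rep_laver U = (\<Union>n\<in>M. Rep_laver (S n))" "stem_of \<sigma> U"
    using laver_condition by blast
  then show thesis using that dense_below_union S by blast
qed

text \<open>
  If no pure extension decides, then the nodes without a deciding pure extension contain a tree
  with the same stem, since infinitely many deciding successors could be amalgamated; but some
  extension of that tree decides.
\<close>

lemma pure_decision:
  assumes \<phi>: "regular \<phi>" and p: "stem_of \<sigma> p"
  shows "\<exists>q\<le>p. stem_of \<sigma> q \<and> decides q \<phi>"
proof -
  define good where "good s \<longleftrightarrow> (\<exists>q\<le>restrict p s. stem_of s q \<and> decides q \<phi>)" for s
  have step: "finite {n. s @ [n] \<in> Rep_laver p \<and> good (s @ [n])}"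
    if s: "s \<in> Rep_laver p" "prefix \<sigma> s" "\<not> good s" for s
  proof (rule ccontr)
    assume inf: "infinite {n. s @ [n] \<in> Rep_laver p \<and> good (s @ [n])}"
    \<comment> \<open>Good successors may give either answer; one answer \<open>\<psi>\<close>
      occurs for infinitely many of them, and only those are amalgamated.\<close>
    define G where "G \<psi> = {n. s @ [n] \<in> Rep_laver p \<and>
      (\<exists>q\<le>restrict p (s @ [n]). stem_of (s @ [n]) q \<and> \<psi> q)}" for \<psi>
    have "{n. s @ [n] \<in> Rep_laver p \<and> good (s @ [n])} \<subseteq> G \<phi> \<union> G (\<^bold>\<not> \<phi>)"
      unfolding good_def decides_def G_def by blast
    then obtain \<psi> where \<psi>: "\<psi> = \<phi> \<or> \<psi> = (\<^bold>\<not> \<phi>)" "infinite (G \<psi>)"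
      using inf finite_subset by (metis finite_UnI)
    have reg: "regular \<psi>" using \<psi>(1) \<phi> regular_not by blast
    obtain S where S: "\<And>n. n \<in> G \<psi> \<Longrightarrow> S n \<le> restrict p (s @ [n])"
      "\<And>n. n \<in> G \<psi> \<Longrightarrow> stem_of (s @ [n]) (S n)" "\<And>n. n \<in> G \<psi> \<Longrightarrow> \<psi> (S n)"
    proof -
      have "\<forall>n\<in>G \<psi>. \<exists>q. q \<le> restrict p (s @ [n]) \<and> stem_of (s @ [n]) q \<and> \<psi> q"
        unfolding G_def by blast
      from bchoice[OF this] show thesis using that by blast
    qed
    obtain U where U: "stem_of s U" "Rep_laver U = (\<Union>n\<in>G \<psi>. Rep_laver (S n))"
      "dense_below U (\<lambda>r. \<exists>n\<in>G \<psi>. r \<le> S n)"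
      using laver_union[OF \<psi>(2) S(2)] by blast
    have "\<psi> U"
      by (rule regular_by_dense[OF reg U(3)]) (use S(3) regular_mono[OF reg] in blast)
    moreover have "U \<le> restrict p s"
    proof (rule le_restrict[OF p s(1,2)])
      have "Rep_laver (S n) \<subseteq> Rep_laver p" if "n \<in> G \<psi>" for n
      proof -
        have "s @ [n] \<in> Rep_laver p" using that unfolding G_def by blast
        moreover have "prefix \<sigma> (s @ [n])" using s(2) by (meson prefixI prefix_order.trans)
        ultimately have "restrict p (s @ [n]) \<le> p" using restrict_le[OF p] by blast
        then show ?thesis using S(1)[OF that] unfolding less_eq_laver_def by blast
      qed
      then show "U \<le> p" unfolding less_eq_laver_def U(2) by blast
      show "comparable s t" if "t \<in> Rep_laver U" for t
        using that U(1) laver_with_stem_comparable unfolding stem_of_def by blast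
    qed
    ultimately have "good s" unfolding good_def decides_def using U(1) \<psi>(1) by blast
    then show False using s(3) by blast
  qed
  have "good \<sigma>"
  proof (rule ccontr)
    assume bad: "\<not> good \<sigma>"
    define T where "T = {t \<in> Rep_laver p. \<forall>s. prefix \<sigma> s \<longrightarrow> prefix s t \<longrightarrow> \<not> good s}"
    have P: "laver_with_stem \<sigma> (Rep_laver p)" using p by (simp add: stem_of_def)
    have "laver_with_stem \<sigma> T"
      unfolding laver_with_stem_def
    proof (intro conjI ballI allI impI)
      fix t s assume "t \<in> T" "prefix s t"
      then show "s \<in> T"
        using laver_with_stem_closed[OF P] prefix_order.trans unfolding T_def by blast
    next
      show "\<sigma> \<in> T" using bad laver_with_stem_in[OF P] prefix_order.antisym unfolding T_def by blast
    next
      fix t assume "t \<in> T"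
      then show "comparable \<sigma> t" using laver_with_stem_comparable[OF P] unfolding T_def by blast
    next
      fix t assume t: "t \<in> T" "prefix \<sigma> t"
      have "{n. t @ [n] \<in> Rep_laver p} - {n. t @ [n] \<in> Rep_laver p \<and> good (t @ [n])}
          \<subseteq> {n. t @ [n] \<in> T}"
        using t(1) unfolding T_def by auto
      moreover have "infinite ({n. t @ [n] \<in> Rep_laver p} - {n. t @ [n] \<in> Rep_laver p \<and> good (t @ [n])})"
        using laver_with_stem_infinite[OF P _ t(2)] step[of t] t unfolding T_def
        by (intro Diff_infinite_finite) auto
      ultimately show "infinite {n. t @ [n] \<in> T}" using finite_subset by blast
    qed
    then obtain q where q: "Rep_laver q = T" "stem_of \<sigma> q" using laver_condition by blast
    \<comment> \<open>With \<open>s\<close> the stem of \<open>r\<close>, the condition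
      \<open>r\<close> is a deciding pure extension of \<open>restrict p s\<close>, so
      \<open>s\<close> is good although it lies in \<open>T\<close>.\<close>
    obtain r where r: "r \<le> q" "decides r \<phi>" using dense_decides by blast
    obtain s where s: "stem_of s r" using stem_of_ex by blast
    have ps: "prefix \<sigma> s" using stem_mono[OF q(2) s r(1)] .
    have sT: "s \<in> T"
      using s r(1) q(1) laver_with_stem_in unfolding stem_of_def less_eq_laver_def by blast
    have "q \<le> p" unfolding less_eq_laver_def q(1) T_def by blast
    then have "r \<le> p" using r(1) by simp
    moreover have "s \<in> Rep_laver p" using sT unfolding T_def by blast
    ultimately have "r \<le> restrict p s"
      using le_restrict[OF p _ ps] s laver_with_stem_comparable unfolding stem_of_def by blast
    then have "good s" unfolding good_def using s r(2) by blast
    then show False using sT ps unfolding T_def by blast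
  qed
  then obtain q where "q \<le> restrict p \<sigma>" "stem_of \<sigma> q" "decides q \<phi>" unfolding good_def by blast
  moreover have "restrict p \<sigma> \<le> p"
    using restrict_le[OF p] laver_with_stem_in p unfolding stem_of_def by blast
  ultimately show ?thesis by (meson order_trans)
qed

text \<open>
  Level-by-level fusion. Nodes above \<open>\<sigma>\<close> are \<open>\<sigma> @ rev r\<close>, so that the condition attached to a node
  is computed from that of its predecessor by recursion on the list \<open>r\<close>.
\<close>

primrec fusion_condition :: "(nat \<Rightarrow> laver sentence) \<Rightarrow> nat list \<Rightarrow> laver \<Rightarrow> nat list \<Rightarrow> laver" where
  "fusion_condition \<phi> \<sigma> p [] = (SOME q. q \<le> p \<and> stem_of \<sigma> q \<and> decides q (\<phi> 0))"
| "fusion_condition \<phi> \<sigma> p (n # r) =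
     (SOME q. q \<le> restrict (fusion_condition \<phi> \<sigma> p r) (\<sigma> @ rev (n # r)) \<and>
        stem_of (\<sigma> @ rev (n # r)) q \<and> decides q (\<phi> (Suc (length r))))"

primrec fusion_node :: "(nat \<Rightarrow> laver sentence) \<Rightarrow> nat list \<Rightarrow> laver \<Rightarrow> nat list \<Rightarrow> bool" where
  "fusion_node \<phi> \<sigma> p [] \<longleftrightarrow> True"
| "fusion_node \<phi> \<sigma> p (n # r) \<longleftrightarrow> fusion_node \<phi> \<sigma> p r \<and>
     \<sigma> @ rev (n # r) \<in> Rep_laver (fusion_condition \<phi> \<sigma> p r)"

lemma fusion:
  assumes \<phi>: "\<And>n. regular (\<phi> n)" and p: "stem_of \<sigma> p"
  shows "\<exists>q\<le>p. stem_of \<sigma> q \<and>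
    (\<forall>s\<in>Rep_laver q. prefix \<sigma> s \<longrightarrow> decides (restrict q s) (\<phi> (length s - length \<sigma>)))"
proof -
  let ?K = "fusion_condition \<phi> \<sigma> p" and ?ok = "fusion_node \<phi> \<sigma> p"
  have K_Nil: "?K [] \<le> p \<and> stem_of \<sigma> (?K []) \<and> decides (?K []) (\<phi> 0)"
    unfolding fusion_condition.simps by (rule someI_ex) (use pure_decision[OF \<phi> p] in blast)
  have K_Cons: "?K (n # r) \<le> restrict (?K r) (\<sigma> @ rev (n # r)) \<and>
      stem_of (\<sigma> @ rev (n # r)) (?K (n # r)) \<and> decides (?K (n # r)) (\<phi> (Suc (length r)))"
    if "\<sigma> @ rev (n # r) \<in> Rep_laver (?K r)" "stem_of (\<sigma> @ rev r) (?K r)" for n r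
    unfolding fusion_condition.simps
  proof (rule someI_ex, goal_cases)
    case 1
    have "stem_of (\<sigma> @ rev (n # r)) (restrict (?K r) (\<sigma> @ rev (n # r)))"
      by (rule restrict(2)[OF that(2,1)]) simp
    then show ?case using pure_decision[OF \<phi>] by blast
  qed
  have K: "?K r \<le> p \<and> stem_of (\<sigma> @ rev r) (?K r) \<and> decides (?K r) (\<phi> (length r))"
    if "?ok r" for r
    using that
  proof (induction r)
    case Nil
    then show ?case using K_Nil by simp
  next
    case (Cons n r)
    then have IH: "?K r \<le> p" "stem_of (\<sigma> @ rev r) (?K r)" "\<sigma> @ rev (n # r) \<in> Rep_laver (?K r)"
      by auto
    then have "restrict (?K r) (\<sigma> @ rev (n # r)) \<le> ?K r" by (intro restrict_le) auto
    then show ?case using K_Cons[OF IH(3,2)] IH(1) by (auto intro: order_trans)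
  qed
  have K_mono: "?K (n # r) \<le> ?K r" if "?ok (n # r)" for n r
  proof -
    have r: "\<sigma> @ rev (n # r) \<in> Rep_laver (?K r)" "stem_of (\<sigma> @ rev r) (?K r)"
      using that K[of r] by auto
    have "restrict (?K r) (\<sigma> @ rev (n # r)) \<le> ?K r" using r by (intro restrict_le) auto
    then show ?thesis using K_Cons[OF r] by (auto intro: order_trans)
  qed
  have ok_append: "?ok r \<and> ?K (r' @ r) \<le> ?K r" if "?ok (r' @ r)" for r' r
    using that
  proof (induction r')
    case (Cons n r')
    then have "?ok r" "?K (r' @ r) \<le> ?K r" by auto
    moreover have "?K (n # r' @ r) \<le> ?K (r' @ r)" using K_mono[of n "r' @ r"] Cons(2) by simp
    ultimately show ?case by (auto intro: order_trans)
  qed simp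
  have in_K: "\<sigma> @ rev r \<in> Rep_laver (?K r)" if "?ok r" for r
    using K[OF that] laver_with_stem_in unfolding stem_of_def by blast
  \<comment> \<open>Up to the stem nothing changes; above it a node is kept if each of its steps
    lies in the condition attached to the preceding node.\<close>
  define T where "T = {s. prefix s \<sigma>} \<union> {\<sigma> @ rev r | r. ?ok r}"
  have T_above: "\<sigma> @ rev r \<in> T \<longleftrightarrow> ?ok r" for r
    unfolding T_def by (auto simp: prefix_def)
  have T_split: "prefix s \<sigma> \<or> (\<exists>r. s = \<sigma> @ rev r \<and> ?ok r)" if "s \<in> T" for s
    using that unfolding T_def by blast
  have T_laver: "laver_with_stem \<sigma> T"
    unfolding laver_with_stem_def
  proof (intro conjI ballI allI impI)
    fix t s assume t: "t \<in> T" "prefix s t"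
    show "s \<in> T"
    proof (cases "prefix s \<sigma>")
      case False
      then obtain r where r: "t = \<sigma> @ rev r" "?ok r"
        using T_split[OF t(1)] t(2) prefix_order.trans by blast
      then have "prefix \<sigma> s" using t(2) False by (meson prefixI prefix_same_cases)
      then obtain u v where s: "s = \<sigma> @ u" and "\<sigma> @ rev r = s @ v"
        using t(2) r(1) by (auto simp: prefix_def)
      then have "r = rev v @ rev u" by (metis append_assoc rev_append rev_rev_ident same_append_eq)
      then have "?ok (rev u)" using ok_append r(2) by blast
      then show ?thesis using T_above[of "rev u"] s by simp
    qed (simp add: T_def)
  next
    show "\<sigma> \<in> T" unfolding T_def by simp
  next
    fix t assume "t \<in> T"
    then show "comparable \<sigma> t" using T_split unfolding comparable_def by fastforce
  next
    fix t assume t: "t \<in> T" "prefix \<sigma> t"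
    then obtain r where r: "t = \<sigma> @ rev r" by (metis prefix_def rev_rev_ident)
    then have ok: "?ok r" using t(1) T_above by blast
    have "{n. t @ [n] \<in> T} = {n. t @ [n] \<in> Rep_laver (?K r)}"
      using T_above[of "_ # r"] ok r by auto
    then show "infinite {n. t @ [n] \<in> T}"
      using K[OF ok] in_K[OF ok] laver_with_stem_infinite[of "\<sigma> @ rev r" _ t] r
      unfolding stem_of_def by simp
  qed
  then obtain q where q: "Rep_laver q = T" "stem_of \<sigma> q" using laver_condition by blast
  \<comment> \<open>Conditions decrease along a branch, so every node of \<open>T\<close> comparable
    with a given one lies in the condition attached to the latter. Thus \<open>restrict q s\<close>
    inherits the decision made at \<open>s\<close>.\<close>
  have below_K: "u \<in> Rep_laver (?K r)" if u: "u \<in> T" "comparable (\<sigma> @ rev r) u" "?ok r" for u r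
  proof (cases "prefix u (\<sigma> @ rev r)")
    case True
    then show ?thesis using in_K K laver_with_stem_closed u(3) unfolding stem_of_def by blast
  next
    case False
    then obtain v where v: "u = \<sigma> @ rev r @ v"
      using u(2) unfolding comparable_def by (auto simp: prefix_def)
    then have "?ok (rev v @ r)" using u(1) T_above[of "rev v @ r"] by simp
    then show ?thesis using ok_append[of "rev v" r] in_K[of "rev v @ r"] v
      unfolding less_eq_laver_def by auto
  qed
  have "q \<le> p"
    unfolding less_eq_laver_def q(1)
  proof
    fix u assume "u \<in> T"
    then have "u \<in> Rep_laver (?K [])"
      using below_K[of u "[]"] T_laver laver_with_stem_comparable by simp
    then show "u \<in> Rep_laver p" using K_Nil unfolding less_eq_laver_def by blast
  qed
  moreover have "decides (restrict q s) (\<phi> (length s - length \<sigma>))"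
    if s: "s \<in> Rep_laver q" "prefix \<sigma> s" for s
  proof -
    obtain r where r: "s = \<sigma> @ rev r" using s(2) by (metis prefix_def rev_rev_ident)
    then have ok: "?ok r" using s(1) T_above q(1) by blast
    have "restrict q s \<le> ?K r"
      unfolding less_eq_laver_def restrict(1)[OF q(2) s] restrict_tree_def
      using below_K[OF _ _ ok] q(1) r by blast
    then show ?thesis using K[OF ok] decides_mono[OF \<phi>] r by auto
  qed
  ultimately show ?thesis using q(2) by blast
qed

text \<open>The weakest condition with stem \<open>s\<close>. It says only that the generic branch
  passes through \<open>s\<close>, and there are countably many such conditions.\<close>

definition full_tree :: "nat list \<Rightarrow> laver" where
  "full_tree s = Abs_laver {t. comparable s t}"

lemma Rep_full_tree: "Rep_laver (full_tree s) = {t. comparable s t}"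
proof -
  have "stem_of [] top"
    unfolding stem_of_def top_laver_def
    by (subst Abs_laver_inverse) (auto simp: laver_tree_UNIV laver_with_stem_def comparable_def)
  moreover have "Rep_laver top = UNIV"
    unfolding top_laver_def by (simp add: Abs_laver_inverse laver_tree_UNIV)
  ultimately show ?thesis
    using restrict(1)[of "[]" top s] unfolding restrict_def full_tree_def restrict_tree_def by simp
qed

lemma full_tree_Nil: "full_tree [] = top"
  unfolding full_tree_def top_laver_def by (rule arg_cong[of _ _ Abs_laver]) (auto simp: comparable_def)

text \<open>After fusion, \<open>\<phi> n\<close> is decided at every node \<open>n\<close> levels
  above the stem of \<open>q\<close>. \<open>R\<close> lists the nodes that decide positively, so
  all the \<open>\<phi> n\<close> are read off from the generic branch by a countable ground-model
  set.\<close>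

lemma continuous_reading:
  fixes \<phi> :: "nat \<Rightarrow> laver sentence"
  assumes \<phi>: "\<And>n. regular (\<phi> n)"
  shows "\<exists>q\<le>p. \<exists>R. \<forall>n. \<forall>r\<le>q. \<phi> n r \<longleftrightarrow> dense_below r (\<lambda>r'. \<exists>s. (n, s) \<in> R \<and> r' \<le> full_tree s)"
proof -
  obtain \<sigma> where "stem_of \<sigma> p" using stem_of_ex by blast
  from fusion[of \<phi>, OF \<phi> this] obtain q where q: "q \<le> p" "stem_of \<sigma> q"
    "\<And>s. s \<in> Rep_laver q \<Longrightarrow> prefix \<sigma> s \<Longrightarrow> decides (restrict q s) (\<phi> (length s - length \<sigma>))"
    by blast
  define R where "R = {(n, s). s \<in> Rep_laver q \<and> prefix \<sigma> s \<and> length s = length \<sigma> + n \<and>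
    \<phi> n (restrict q s)}"
  have "dense_below r (\<lambda>r'. \<exists>s. (n, s) \<in> R \<and> r' \<le> full_tree s)" if r: "r \<le> q" "\<phi> n r" for n r
  proof (rule dense_belowI)
    fix r1 assume r1: "r1 \<le> r"
    obtain \<tau> where \<tau>: "stem_of \<tau> r1" using stem_of_ex by blast
    then obtain t where t: "t \<in> Rep_laver r1" "prefix \<tau> t" "length \<sigma> + n \<le> length t"
      using laver_long_node unfolding stem_of_def by blast
    \<comment> \<open>The initial segment of \<open>t\<close> on the level where \<open>q\<close>
      decides \<open>\<phi> n\<close>.\<close>
    define s where "s = take (length \<sigma> + n) t"
    have sub: "Rep_laver r1 \<subseteq> Rep_laver q" using r1 r(1) unfolding less_eq_laver_def by blast
    have st: "prefix s t" unfolding s_def by (rule take_is_prefix)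
    have "length s = length \<sigma> + n" unfolding s_def using t(3) by simp
    moreover have sq: "s \<in> Rep_laver q"
      using sub t(1) st q(2) laver_with_stem_closed unfolding stem_of_def by blast
    moreover from calculation have ps: "prefix \<sigma> s"
      using comparable_length laver_with_stem_comparable q(2) unfolding stem_of_def by simp
    moreover define r' where "r' = restrict r1 t"
    have r'1: "r' \<le> r1" unfolding r'_def by (rule restrict_le[OF \<tau> t(1,2)])
    have cmp: "comparable s u" if "u \<in> Rep_laver r'" for u
    proof -
      have "comparable t u"
        using that unfolding r'_def restrict(1)[OF \<tau> t(1,2)] restrict_tree_def by blast
      then show ?thesis using st unfolding comparable_def
        by (meson prefix_order.trans prefix_same_cases)
    qed
    have "r' \<le> restrict q s"
      using le_restrict[OF q(2) sq ps] cmp r'1 r1 r(1) order_trans by meson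
    moreover have "\<phi> n r'" using regular_mono[OF \<phi> r(2)] r'1 r1 order_trans by blast
    moreover have "decides (restrict q s) (\<phi> n)" using q(3)[OF sq ps] calculation(1) by simp
    ultimately have "(n, s) \<in> R"
      unfolding R_def decides_def not_iff by blast
    moreover have "r' \<le> full_tree s" unfolding less_eq_laver_def Rep_full_tree using cmp by blast
    ultimately show "\<exists>r'\<le>r1. \<exists>s. (n, s) \<in> R \<and> r' \<le> full_tree s" using r'1 by blast
  qed
  moreover have "\<phi> n r" if r: "r \<le> q" "dense_below r (\<lambda>r'. \<exists>s. (n, s) \<in> R \<and> r' \<le> full_tree s)" for n r
  proof (rule regular_by_dense[OF \<phi> r(2)])
    fix r' assume r': "r' \<le> r" "\<exists>s. (n, s) \<in> R \<and> r' \<le> full_tree s"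
    then obtain s where s: "(n, s) \<in> R" "r' \<le> full_tree s" by blast
    have "r' \<le> q" using r'(1) r(1) by (rule order_trans)
    then have "r' \<le> restrict q s"
      using s le_restrict[OF q(2), of s r'] unfolding R_def less_eq_laver_def Rep_full_tree by blast
    then show "\<phi> n r'" using s(1) regular_mono[OF \<phi>] unfolding R_def by blast
  qed
  ultimately show ?thesis using q(1) by blast
qed

section \<open>Weakly dominating families and Laver forcing\<close>

text \<open>
  The \<open>i\<close>-th block of \<open>2\<^sup>i\<close> intervals of \<open>X\<close> is indexed by the subsets of \<open>{..<i}\<close>; the branch through
  \<open>f\<close> picks the interval of index \<open>f \<inter> {..<i}\<close> in each block.
\<close>

definition branch_index :: "nat set \<Rightarrow> nat \<Rightarrow> nat" where
  "branch_index f i = 2 ^ i + set_encode (f \<inter> {..<i})"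

definition branch_interval :: "nat set \<Rightarrow> nat set \<Rightarrow> nat \<Rightarrow> nat set" where
  "branch_interval X f i = {enumerate X (branch_index f i)..<enumerate X (branch_index f i + 1)}"

text \<open>A combinatorial way to force that almost all values of the generic branch lie in the
  intervals picked by \<open>f\<close>: one bound \<open>N\<close> serves all nodes of the
  tree.\<close>

definition follows :: "nat set \<Rightarrow> nat set \<Rightarrow> laver \<Rightarrow> bool" where
  "follows X f p \<longleftrightarrow>
     (\<exists>N. \<forall>s n. N \<le> length s \<longrightarrow> s @ [n] \<in> Rep_laver p \<longrightarrow> n \<in> (\<Union>i. branch_interval X f i))"

section \<open>Almost disjoint unions of intervals\<close>

lemma set_encode_bound: "set_encode (f \<inter> {..<i}) < 2 ^ i"
proof -
  have "set_encode (f \<inter> {..<i}) \<le> (\<Sum>k<i. 2 ^ k)"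
    unfolding set_encode_def by (rule sum_mono2) auto
  also have "\<dots> < 2 ^ i" using sum_power2[of i] by (simp add: atLeast0LessThan)
  finally show ?thesis .
qed

text \<open>Block \<open>i\<close> occupies the indices from \<open>2 ^ i\<close> to below
  \<open>2 ^ Suc i\<close>, so an index reveals first \<open>i\<close> and then the encoded part of
  \<open>f\<close>.\<close>

lemma branch_index_inj:
  assumes "branch_index f i = branch_index f' i'"
  shows "i = i' \<and> f \<inter> {..<i} = f' \<inter> {..<i}"
proof -
  have lt: "i \<le> i'" if "branch_index f i = branch_index f' i'" for f f' i i'
  proof (rule ccontr)
    assume "\<not> i \<le> i'"
    then have "2 * 2 ^ i' \<le> (2::nat) ^ i" using power_increasing[of "Suc i'" i "2::nat"] by simp
    then show False
      using that set_encode_bound[of f' i'] unfolding branch_index_def by linarith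
  qed
  have "i = i'" using lt[OF assms] lt[OF assms[symmetric]] by simp
  then have "set_encode (f \<inter> {..<i}) = set_encode (f' \<inter> {..<i})"
    using assms unfolding branch_index_def by simp
  then show ?thesis
    using \<open>i = i'\<close> inj_onD[OF inj_on_set_encode] by simp
qed

text \<open>In blocks after a point \<open>k\<close> where \<open>f\<close> and \<open>f'\<close>
  differ, the two pick intervals of different index, which are disjoint; only blocks up to
  \<open>k\<close> can contribute.\<close>

lemma finite_branch_inter:
  assumes X: "infinite X" and "f \<noteq> f'"
  shows "finite ((\<Union>i. branch_interval X f i) \<inter> (\<Union>i. branch_interval X f' i))"
proof -
  obtain k where k: "(k \<in> f) \<noteq> (k \<in> f')" using assms(2) by blast
  have "(\<Union>i. branch_interval X f i) \<inter> (\<Union>i. branch_interval X f' i) \<subseteq> (\<Union>i\<le>k. branch_interval X f i)"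
  proof
    fix n assume "n \<in> (\<Union>i. branch_interval X f i) \<inter> (\<Union>i. branch_interval X f' i)"
    then obtain i i' where n: "n \<in> branch_interval X f i" "n \<in> branch_interval X f' i'" by blast
    have mono: "a < Suc b" if "enumerate X a < enumerate X (Suc b)" for a b
      using that X enumerate_mono_iff by blast
    have "branch_index f i = branch_index f' i'"
      using n mono[of "branch_index f i" "branch_index f' i'"] mono[of "branch_index f' i'" "branch_index f i"]
      unfolding branch_interval_def by (simp del: enumerate.simps)
    then have "f \<inter> {..<i} = f' \<inter> {..<i}" using branch_index_inj by blast
    then have "i \<le> k" using k by (metis IntD1 IntI lessThan_iff not_le)
    then show "n \<in> (\<Union>i\<le>k. branch_interval X f i)" using n by blast
  qed
  moreover have "finite (\<Union>i\<le>k. branch_interval X f i)" by (simp add: branch_interval_def)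
  ultimately show ?thesis using finite_subset by blast
qed

lemma follows_mono: "follows X f p \<Longrightarrow> q \<le> p \<Longrightarrow> follows X f q"
  unfolding follows_def less_eq_laver_def by blast

text \<open>This makes \<open>h\<close> a function: a node beyond both bounds would have its
  infinitely many successors in a finite intersection.\<close>

lemma follows_unique:
  assumes X: "infinite X" and "follows X f p" "follows X f' p"
  shows "f = f'"
proof (rule ccontr)
  assume "f \<noteq> f'"
  obtain N where N: "\<And>s n. N \<le> length s \<Longrightarrow> s @ [n] \<in> Rep_laver p \<Longrightarrow> n \<in> (\<Union>i. branch_interval X f i)"
    using assms(2) unfolding follows_def by blast
  obtain N' where N': "\<And>s n. N' \<le> length s \<Longrightarrow> s @ [n] \<in> Rep_laver p \<Longrightarrow> n \<in> (\<Union>i. branch_interval X f' i)"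
    using assms(3) unfolding follows_def by blast
  obtain \<sigma> where \<sigma>: "laver_with_stem \<sigma> (Rep_laver p)" using stem_of_ex unfolding stem_of_def by blast
  obtain u where u: "u \<in> Rep_laver p" "prefix \<sigma> u" "max N N' \<le> length u"
    using laver_long_node[OF \<sigma>] by blast
  have "{n. u @ [n] \<in> Rep_laver p} \<subseteq> (\<Union>i. branch_interval X f i) \<inter> (\<Union>i. branch_interval X f' i)"
    using N[of u] N'[of u] u(3) by auto
  then show False
    using laver_with_stem_infinite[OF \<sigma> u(1,2)] finite_branch_inter[OF X \<open>f \<noteq> f'\<close>] finite_subset by blast
qed

text \<open>The element of \<open>Y\<close> after \<open>a\<close> is taken beyond some member, at
  or above \<open>a\<close>, of each \<open>A m\<close> with \<open>m \<le> a\<close>.\<close>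

lemma sparse_set:
  fixes A :: "nat \<Rightarrow> nat set"
  assumes A: "\<And>m. infinite (A m)"
  shows "\<exists>Y. infinite Y \<and>
    (\<forall>m. \<forall>a\<in>Y. \<forall>b\<in>Y. m \<le> a \<longrightarrow> a < b \<longrightarrow> (\<exists>n\<in>A m. a \<le> n \<and> n < b))"
proof -
  define l where "l m a = (LEAST n. n \<in> A m \<and> a \<le> n)" for m a
  \<comment> \<open>The sum bounds each of its terms, so \<open>h a\<close> exceeds
    \<open>l m a\<close> for all \<open>m \<le> a\<close>.\<close>
  define h where "h a = Suc (\<Sum>m\<le>a. l m a)" for a
  define y where "y k = (h ^^ k) 0" for k
  have l: "l m a \<in> A m \<and> a \<le> l m a" for m a
    unfolding l_def by (rule LeastI_ex) (use A[of m] infinite_nat_iff_unbounded_le in blast)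
  have h: "l m a < h a" if "m \<le> a" for m a
    unfolding h_def using that member_le_sum[of m "{..a}" "\<lambda>m. l m a"] by simp
  have y_Suc: "y (Suc k) = h (y k)" for k by (simp add: y_def)
  have "y k < y (Suc k)" for k
    using h[of 0 "y k"] l[of 0 "y k"] unfolding y_Suc by simp
  then have sm: "strict_mono y" by (simp add: strict_mono_Suc_iff)
  have "infinite (range y)"
    using sm by (simp add: finite_image_iff strict_mono_imp_inj_on)
  moreover have "\<exists>n\<in>A m. a \<le> n \<and> n < b" if "a \<in> range y" "b \<in> range y" "m \<le> a" "a < b" for m a b
  proof -
    obtain j k where jk: "a = y j" "b = y k" using \<open>a \<in> range y\<close> \<open>b \<in> range y\<close> by blast
    then have "Suc j \<le> k" using \<open>a < b\<close> strict_mono_less[OF sm] by simp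
    then have "h a \<le> b" using jk y_Suc strict_mono_less_eq[OF sm, of "Suc j" k] by simp
    then show ?thesis using h[OF \<open>m \<le> a\<close>] l[of m a] by (intro bexI[of _ "l m a"]) auto
  qed
  ultimately show ?thesis by (intro exI[of _ "range y"] conjI allI ballI impI)
qed

text \<open>One \<open>X\<close> serves all \<open>f\<close>: in a good block every interval,
  whichever \<open>f\<close> picks, holds two elements of the sparse set and so a successor of each
  node coded early enough.\<close>

lemma weakly_dominating_follows:
  assumes F: "weakly_dominating F"
  shows "\<exists>X\<in>F. \<forall>f. \<exists>q\<le>p. follows X f q"
proof -
  obtain \<sigma> where \<sigma>: "laver_with_stem \<sigma> (Rep_laver p)" using stem_of_ex unfolding stem_of_def by blast
  let ?T = "Rep_laver p"
  \<comment> \<open>\<open>m\<close> runs through codes of nodes; the default \<open>UNIV\<close>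
    keeps \<open>A m\<close> infinite when \<open>m\<close> codes no node above the stem.\<close>
  define A :: "nat \<Rightarrow> nat set" where
    "A m = (let s = from_nat m in if s \<in> ?T \<and> prefix \<sigma> s then {n. s @ [n] \<in> ?T} else UNIV)" for m
  have "infinite (A m)" for m
    unfolding A_def Let_def using laver_with_stem_infinite[OF \<sigma>] by auto
  from sparse_set[of A, OF this] obtain Y where Y: "infinite Y"
    "\<forall>m. \<forall>a\<in>Y. \<forall>b\<in>Y. m \<le> a \<longrightarrow> a < b \<longrightarrow> (\<exists>n\<in>A m. a \<le> n \<and> n < b)"
    by (elim exE conjE)
  obtain X where X: "X \<in> F" "\<exists>\<^sub>\<infinity>i. \<forall>j<2 ^ i.
      card ({enumerate X (2 ^ i + j)..<enumerate X (2 ^ i + j + 1)} \<inter> Y) \<ge> 2"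
    using F Y(1) unfolding weakly_dominating_def by blast
  have Xinf: "infinite X" using F X(1) unfolding weakly_dominating_def by blast
  have "\<exists>q\<le>p. follows X f q" for f
  proof -
    let ?J = "\<Union>i. branch_interval X f i"
    have succ: "infinite ({n. t @ [n] \<in> ?T} \<inter> ?J)" if t: "t \<in> ?T" "prefix \<sigma> t" for t
      unfolding infinite_nat_iff_unbounded_le
    proof
      fix M
      define m where "m = to_nat t"
      have Am: "A m = {n. t @ [n] \<in> ?T}" unfolding A_def m_def using t by simp
      obtain i where i: "i \<ge> max M m" "\<And>j. j < 2 ^ i \<Longrightarrow>
          card ({enumerate X (2 ^ i + j)..<enumerate X (2 ^ i + j + 1)} \<inter> Y) \<ge> 2"
        using X(2) unfolding INFM_nat_le by blast
      \<comment> \<open>Goodness covers all \<open>2 ^ i\<close> intervals of the block, in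
        particular the one whose offset encodes \<open>f\<close> below \<open>i\<close>.\<close>
      have "card (branch_interval X f i \<inter> Y) \<ge> 2"
        using i(2)[OF set_encode_bound[of f i]] unfolding branch_interval_def branch_index_def .
      then have "\<not> (\<forall>a\<in>branch_interval X f i \<inter> Y. \<forall>b\<in>branch_interval X f i \<inter> Y. a = b)"
        by (subst card_le_Suc0_iff_eq[symmetric]) (simp_all add: branch_interval_def del: enumerate.simps)
      then obtain a b where ab: "a \<in> branch_interval X f i \<inter> Y" "b \<in> branch_interval X f i \<inter> Y" "a < b"
        by (auto simp: neq_iff)
      \<comment> \<open>The interval starts above \<open>i\<close>, hence beyond both
        \<open>M\<close> and the code \<open>m\<close> of \<open>t\<close>, so sparseness applies
        between \<open>a\<close> and \<open>b\<close>.\<close>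
      have "i < branch_index f i" unfolding branch_index_def by (simp add: trans_less_add1)
      also have "\<dots> \<le> enumerate X (branch_index f i)" using le_enumerate[OF Xinf] .
      also have "\<dots> \<le> a" using ab(1) unfolding branch_interval_def by simp
      finally have "max M m \<le> a" using i(1) by simp
      then obtain n where "n \<in> A m" "a \<le> n" "n < b" using Y(2)[rule_format, of a b m] ab by auto
      moreover then have "n \<in> branch_interval X f i" using ab unfolding branch_interval_def by auto
      ultimately show "\<exists>n\<ge>M. n \<in> {n. t @ [n] \<in> ?T} \<inter> ?J"
        using Am \<open>max M m \<le> a\<close> by (intro exI[of _ n]) auto
    qed
    \<comment> \<open>Above the stem only steps with values in \<open>?J\<close> are kept;
      \<open>succ\<close> preserves infinite branching.\<close>
    define S where "S = {t \<in> ?T. \<forall>s n. prefix \<sigma> s \<longrightarrow> prefix (s @ [n]) t \<longrightarrow> n \<in> ?J}"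
    have "laver_with_stem \<sigma> S"
      unfolding laver_with_stem_def
    proof (intro conjI ballI allI impI)
      fix t s assume "t \<in> S" "prefix s t"
      then show "s \<in> S"
        using laver_with_stem_closed[OF \<sigma>] prefix_order.trans unfolding S_def by blast
    next
      have "\<not> prefix (s @ [n]) \<sigma>" if "prefix \<sigma> s" for s n
        using prefix_length_le[OF that] prefix_length_le[of "s @ [n]" \<sigma>] by auto
      then show "\<sigma> \<in> S" using laver_with_stem_in[OF \<sigma>] unfolding S_def by blast
    next
      fix t assume "t \<in> S"
      then show "comparable \<sigma> t" using laver_with_stem_comparable[OF \<sigma>] unfolding S_def by blast
    next
      fix t assume t: "t \<in> S" "prefix \<sigma> t"
      have "{n. t @ [n] \<in> ?T} \<inter> ?J \<subseteq> {n. t @ [n] \<in> S}"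
        using t(1) unfolding S_def by auto
      moreover have "t \<in> ?T" using t(1) unfolding S_def by blast
      ultimately show "infinite {n. t @ [n] \<in> S}" using succ[OF _ t(2)] finite_subset by blast
    qed
    then obtain q where q: "Rep_laver q = S" "stem_of \<sigma> q" using laver_condition by blast
    have "q \<le> p" unfolding less_eq_laver_def q(1) S_def by blast
    moreover have "follows X f q"
      unfolding follows_def q(1)
    proof (intro exI[of _ "length \<sigma>"] allI impI)
      fix s n assume s: "length \<sigma> \<le> length s" "s @ [n] \<in> S"
      have "comparable \<sigma> (s @ [n])" using s(2) laver_with_stem_comparable[OF \<sigma>] unfolding S_def by blast
      then have "prefix \<sigma> s"
        using comparable_length comparable_prefix[of \<sigma> "s @ [n]" s] s(1) by simp
      then show "n \<in> ?J" using s(2) unfolding S_def by blast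
    qed
    ultimately show ?thesis by blast
  qed
  then show ?thesis using X(1) by blast
qed

section \<open>The continuum after Laver forcing\<close>

text \<open>A pair \<open>(n, s)\<close> coded in \<open>C\<close> puts \<open>n\<close> into the
  real once the generic branch passes through \<open>s\<close>. In this way ground-model reals act
  as codes for reals of the extension.\<close>

definition coded_real :: "nat set \<Rightarrow> (laver, 'i) name" where
  "coded_real C = real_name {(n, full_tree s) | n s. to_nat (n, s) \<in> C}"

text \<open>The empty sequence stands for the weakest condition, as \<open>full_tree []\<close> is
  \<open>top\<close>; so this codes the ground-model real \<open>X\<close> itself.\<close>

definition real_code :: "nat set \<Rightarrow> nat set" where
  "real_code X = {to_nat (n, [] :: nat list) | n. n \<in> X}"

lemma countable_coded_real: "countable {(n, full_tree s) | n s. to_nat (n, s) \<in> C}"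
proof -
  have "{(n, full_tree s) | n s. to_nat (n, s) \<in> C} \<subseteq> range (\<lambda>(n, s). (n, full_tree s))" by auto
  then show ?thesis by (rule countable_subset) simp
qed

text \<open>Bounds the size of the graph of the bijection. A condition is a set of finite sequences,
  and the tags 0, 1, 2 pack three sets of numbers into one.\<close>

lemma condition_code_lepoll: "(Z :: (laver \<times> nat set \<times> nat set) set) \<lesssim> (UNIV :: nat set set)"
proof -
  define e :: "laver \<times> nat set \<times> nat set \<Rightarrow> nat set" where
    "e = (\<lambda>(p, C, X). (\<lambda>s. to_nat (0::nat, to_nat s)) ` Rep_laver p \<union>
      (\<lambda>n. to_nat (1::nat, n)) ` C \<union> (\<lambda>n. to_nat (2::nat, n)) ` X)"
  have dec: "Rep_laver p = {s. to_nat (0::nat, to_nat s) \<in> e (p, C, X)}"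
    "C = {n. to_nat (1::nat, n) \<in> e (p, C, X)}" "X = {n. to_nat (2::nat, n) \<in> e (p, C, X)}" for p C X
    by (auto simp: e_def)
  have inj: "p = p' \<and> C = C' \<and> X = X'" if eq: "e (p, C, X) = e (p', C', X')" for p C X p' C' X'
    using dec[where p = p and C = C and X = X] dec[where p = p' and C = C' and X = X'] unfolding eq by (simp flip: Rep_laver_inject)
  have "inj_on e Z"
  proof (rule inj_onI)
    fix u v assume eq: "e u = e v"
    obtain p C X p' C' X' where uv: "u = (p, C, X)" "v = (p', C', X')" by (metis prod_cases3)
    show "u = v" using inj[OF eq[unfolded uv]] unfolding uv by simp
  qed
  then show ?thesis unfolding lepoll_def by blast
qed

lemma ex_forces_all: "(\<And>q. \<phi> x q) \<Longrightarrow> (\<^bold>\<exists>x. \<phi> x) p"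
  unfolding ex_iff by (rule dense_below_self) blast

context
  assumes continuum_le: "(UNIV :: nat set set) \<lesssim> (UNIV :: 'i set)"
begin

lemma coded_real_subset_omega: "((coded_real C :: (laver, 'i) name) \<^bold>\<subseteq> omega_name) p"
  unfolding coded_real_def by (rule real_name_subset_omega[OF continuum_le countable_coded_real])

lemma nat_name_in_coded_real:
  "(nat_name n \<^bold>\<in> (coded_real C :: (laver, 'i) name)) p \<longleftrightarrow>
    dense_below p (\<lambda>q. \<exists>s. to_nat (n, s) \<in> C \<and> q \<le> full_tree s)"
proof -
  have "(\<exists>t. (n, t) \<in> {(n, full_tree s) | n s. to_nat (n, s) \<in> C} \<and> q \<le> t) \<longleftrightarrow>
    (\<exists>s. to_nat (n, s) \<in> C \<and> q \<le> full_tree s)" for q by blast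
  then show ?thesis
    unfolding coded_real_def nat_name_in_real_name[OF continuum_le countable_coded_real] by simp
qed

lemma real_code_inj:
  assumes "((coded_real (real_code X) :: (laver, 'i) name) \<^bold>= coded_real (real_code Y)) p"
  shows "X = Y"
proof -
  have mem: "(nat_name n \<^bold>\<in> (coded_real (real_code X) :: (laver, 'i) name)) p \<longleftrightarrow> n \<in> X" for n X
  proof -
    have "(\<exists>s. to_nat (n, s) \<in> real_code X \<and> q \<le> full_tree s) \<longleftrightarrow> n \<in> X" for q
      by (auto simp: real_code_def full_tree_Nil)
    then show ?thesis unfolding nat_name_in_coded_real by (auto simp: dense_below_def)
  qed
  have "n \<in> X \<longleftrightarrow> n \<in> Y" for n
    unfolding mem[of n, symmetric] using assms forces_mem_cong_right forces_eq_sym by blast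
  then show ?thesis by blast
qed

text \<open>Continuous reading is applied to the statements that \<open>n\<close> belongs to
  \<open>x\<close>; the image of the resulting \<open>R\<close> under \<open>to_nat\<close> is the
  code.\<close>

lemma subset_omega_coded:
  assumes "((x :: (laver, 'i) name) \<^bold>\<subseteq> omega_name) p"
  shows "\<exists>q\<le>p. \<exists>C. (x \<^bold>= coded_real C) q"
proof -
  obtain q R where q: "q \<le> p" "\<And>n r. r \<le> q \<Longrightarrow> (nat_name n \<^bold>\<in> x) r \<longleftrightarrow>
      dense_below r (\<lambda>r'. \<exists>s. (n, s) \<in> R \<and> r' \<le> full_tree s)"
    using continuous_reading[of "\<lambda>n. nat_name n \<^bold>\<in> x" p, OF regular_mem] by blast
  have "to_nat (n, s) \<in> to_nat ` R \<longleftrightarrow> (n, s) \<in> R" for n s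
    by (simp add: inj_image_mem_iff)
  then have "(x \<^bold>= coded_real (to_nat ` R)) q"
    using q(2) regular_mono[OF regular_subset assms q(1)]
    by (intro eq_of_subset_omega[OF continuum_le] coded_real_subset_omega)
      (simp_all add: nat_name_in_coded_real)
  then show ?thesis using q(1) by blast
qed

lemma reals_lepoll_index: "(Z :: nat set set) \<lesssim> (UNIV :: 'i set)"
  using subset_imp_lepoll[of Z UNIV] continuum_le lepoll_trans by blast

lemma continuum_eq_b_plus_eps:
  "continuum_eq_card (ord_check b_plus_eps :: (laver, 'i) name) p"
proof -
  obtain F where F: "weakly_dominating F" "b_plus_eps = |F|" using b_plus_eps(1) by blast
  let ?y = "coded_real :: nat set \<Rightarrow> (laver, 'i) name"
  let ?k = "ord_check_at |F| :: nat set \<Rightarrow> (laver, 'i) name"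
  \<comment> \<open>The map \<open>h\<close> followed by evaluation: \<open>X\<close> goes to the
    real coded by the \<open>f\<close> that it follows, up to forced equality.\<close>
  let ?H = "\<lambda>X C p. \<exists>f. follows X f p \<and> (?y f \<^bold>= ?y C) p"
  have wo: "Well_order |F|" and field: "Field |F| = F"
    by (rule card_of_Well_order, rule Field_card_of)
  have inf: "infinite X" if "X \<in> F" for X using F(1) that unfolding weakly_dominating_def by blast
  \<comment> \<open>The well-order of \<open>F\<close> picks least preimages, and
    \<open>real_code\<close> serves as injection because members of \<open>F\<close> are themselves
    reals. Membership in \<open>F\<close> is built into \<open>H\<close> so that \<open>X\<close> is
    infinite when uniqueness of the followed branch is invoked.\<close>
  interpret forced_cantor_bernstein F "|F| - Id" "\<lambda>C C'. ?y C \<^bold>= ?y C'" "\<lambda>X C p. X \<in> F \<and> ?H X C p" real_code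
  proof
    show "wf ( |F| - Id)" using wo by (simp add: well_order_on_def)
    show "(X, Y) \<in> |F| - Id \<or> (Y, X) \<in> |F| - Id" if "X \<in> F" "Y \<in> F" "X \<noteq> Y" for X Y
      using wo that field unfolding order_on_defs total_on_def by auto
    show "\<exists>X\<in>F. \<exists>q\<le>p. X \<in> F \<and> ?H X C q" for C p
      \<comment> \<open>The chosen \<open>X\<close> works for every \<open>f\<close>, in particular
        for \<open>f = C\<close>.\<close>
      using weakly_dominating_follows[OF F(1), of p] forces_eq_refl by blast
    show "(?y C \<^bold>= ?y C') p" if "X \<in> F \<and> ?H X C p" "X \<in> F \<and> ?H X C' p" for X C C' p
      using that follows_unique[OF inf] forces_eq_sym forces_eq_trans by metis
    show "X \<in> F \<and> ?H X C q" if "X \<in> F \<and> ?H X C p" "q \<le> p" for X C p q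
      using that follows_mono forces_eq_mono by blast
    show "X \<in> F \<and> ?H X C' p" if "X \<in> F \<and> ?H X C p" "(?y C \<^bold>= ?y C') p" for X C C' p
      using that forces_eq_trans by blast
    show "(?y C' \<^bold>= ?y C) p" if "(?y C \<^bold>= ?y C') p" for C C' p
      using that forces_eq_sym by blast
    show "X = Y" if "(?y (real_code X) \<^bold>= ?y (real_code Y)) p" for X Y p
      using real_code_inj[OF that] .
  qed (rule forces_eq_trans forces_eq_mono forces_eq_refl; assumption)+
  have range_y: "range ?y \<lesssim> (UNIV :: 'i set)" and image_k: "?k ` F \<lesssim> (UNIV :: 'i set)"
    using image_lepoll reals_lepoll_index lepoll_trans by blast+
  let ?f = "{(p, opair (?y C) (?k X)) | p C X. X \<in> F \<and> B C X p}"
  have "?f \<subseteq> (\<lambda>(p, C, X). (p, opair (?y C) (?k X))) ` UNIV"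
  proof
    fix z assume "z \<in> ?f"
    then obtain p C X where "z = (\<lambda>(p, C, X). (p, opair (?y C) (?k X))) (p, C, X)" by auto
    then show "z \<in> (\<lambda>(p, C, X). (p, opair (?y C) (?k X))) ` UNIV" by blast
  qed
  then have graph: "?f \<lesssim> (UNIV :: 'i set)"
    by (rule lepoll_trans[OF subset_image_lepoll lepoll_trans[OF condition_code_lepoll continuum_le]])
  have k_inj: "X = Y" if "X \<in> F" "Y \<in> F" "(?k X \<^bold>= ?k Y) q" for X Y q
    using ord_check_at_inj[OF continuum_le wo _ _ _ that(3)] that(1,2) reals_lepoll_index by (simp add: field)
  have bij: "is_bijection (mk_name ?f) (name_of_set (range ?y)) (name_of_set (?k ` F)) q" for q
    by (rule is_bijectionI[OF continuum_le range_y image_k graph])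
      (rule k_inj B_mono B_cong B_total B_fun B_surj B_inj; assumption)+
  \<comment> \<open>The cardinal is a well-order with field \<open>F\<close>, so the elements of its
    check name are the names of its proper initial segments, matched with reals by
    \<open>bij\<close>.\<close>
  have "ord_check b_plus_eps = name_of_set (?k ` F)"
    unfolding ord_check_def name_of_set_def F(2) field by (rule arg_cong[of _ _ mk_name]) auto
  then have "equinumerous (name_of_set (range ?y)) (ord_check b_plus_eps) q" for q
    unfolding equinumerous_def using ex_forces_all[of "\<lambda>f. is_bijection f _ _", OF bij] by simp
  moreover have "is_powerset (name_of_set (range ?y)) omega_name q" for q
    by (rule is_powersetI[OF continuum_le range_y coded_real_subset_omega subset_omega_coded])
  ultimately show ?thesis
    unfolding continuum_eq_card_def
    by (intro ex_forces_all[where x = omega_name] ex_forces_all[where x = "name_of_set (range ?y)"]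
        and_forcesI is_omega_omega_name[OF continuum_le])
qed

end

theorem theorem4p3:
  assumes "(UNIV :: nat set set) \<lesssim> (UNIV :: 'i set)"
  shows "forced (continuum_eq_card (ord_check b_plus_eps :: (laver, 'i) name))"
  unfolding forced_def forces_def using continuum_eq_b_plus_eps[OF assms] by blast

end
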